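(* The following assertion is false: "for every smooth projective real variety $X$ and all integers $0\le q\le n$, one has $\mathrm{Im}(cyc_{q,n}) = N_{2n-q}H_n(X(\mathbb{R});\mathbb{Z}/2)$." That is, there exist a smooth projective real variety $X$ and integers $0\le q\le n$ such that $$\mathrm{Im}\bigl(cyc_{q,n}: RL_qH_n(X)\to H_n(X(\mathbb{R});\mathbb{Z}/2)\bigr)\neq N_{2n-q}H_n(X(\mathbb{R});\mathbb{Z}/2).$$
   Context: Reduced Lawson homology. For a projective complex variety $Y$, let $\mathcal{C}_q(Y)$ be the Chow monoid of effective $q$-cycles and $\mathcal{Z}_q(Y)=(\mathcal{C}_q(Y)(\mathbb{C}))^+$ its naive (algebraic) group completion with the quotient topology. For $U$ quasi-projective with projectivization $U\subseteq\overline{U}$ put $\mathcal{Z}_q(U)=\mathcal{Z}_q(\overline U)/\mathcal{Z}_q(\overline U\setminus U)$ (independent of choices). For a quasi-projective variety $X$ over $\mathbb{R}$ ("real variety"), $G=\mathbb{Z}/2$ acts on $\mathcal{Z}_q(X_{\mathbb{C}})$ by complex conjugation; $\mathcal{Z}_q(X_{\mathbb{C}})^{G}$ is the subgroup of invariant cycles and $\mathcal{Z}_q(X_{\mathbb{C}})^{av}$ the subgroup generated by the cycles $\alpha+\overline{\alpha}$. Set $\mathcal{R}_q(X)=\mathcal{Z}_q(X_{\mathbb{C}})^{G}/\mathcal{Z}_q(X_{\mathbb{C}})^{av}$ (quotient topology) and $RL_qH_{q+i}(X)=\pi_i\mathcal{R}_q(X)$. One has $\mathcal{R}_0(X)=\mathcal{Z}_0(X(\mathbb{R}))/2$,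 so by Dold–Thom $RL_0H_n(X)=H_n(X(\mathbb{R});\mathbb{Z}/2)$, Borel–Moore homology. $s$-map and cycle map. The $s$-map $s:RL_qH_n(X)\to RL_{q-1}H_n(X)$ ($q\ge1$) is induced by the external product $\mathcal{R}_q(X)\wedge\mathcal{R}_0(\mathbb{A}^1)\to\mathcal{R}_q(X\times\mathbb{A}^1)$ with the generator of $\pi_1\mathcal{R}_0(\mathbb{A}^1_{\mathbb{R}})=\mathbb{Z}/2$, followed by the inverse of the flat pull-back equivalence $\mathcal{R}_{q-1}(X)\simeq\mathcal{R}_q(X\times\mathbb{A}^1)$. The generalized cycle map $cyc_{q,n}:RL_qH_n(X)\to RL_0H_n(X)=H_n(X(\mathbb{R});\mathbb{Z}/2)$ is the $q$-fold iterate of $s$. Niveau filtration. $N_pH_n(X(\mathbb{R});\mathbb{Z}/2)$ is the sum of the images of $H_n(V(\mathbb{R});\mathbb{Z}/2)\to H_n(X(\mathbb{R});\mathbb{Z}/2)$ over all closed subvarieties $V\subseteq X$ with $\dim V\le p$. *)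

theory Defs
  imports "HOL-Analysis.Analysis" "HOL-Homology.Homology" "HOL-Library.Function_Algebras"
    "HOL-Library.Extended_Nat" "HOL-Computational_Algebra.Factorial_Ring"
begin

text \<open>
  Conventions. A variety is a reduced, not necessarily irreducible, quasi-projective scheme.
  A reduced closed subscheme of projective \<open>N\<close>-space over the complex (resp. real) numbers is
  represented by its set of complex points, i.e. by the zero set of complex (resp. real)
  homogeneous polynomials. Since \<open>N\<close> has to be quantified, \<open>\<complex>\<^sup>N\<^sup>+\<^sup>1\<close> is
  the set of functions \<^typ>\<open>nat \<Rightarrow> complex\<close> vanishing at all \<open>i > N\<close>.
\<close>

section \<open>Quotient topologies\<close>

definition quotient_topology :: "'a topology \<Rightarrow> ('a \<Rightarrow> 'b) \<Rightarrow> 'b topology" where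
  "quotient_topology T f =
     topology (\<lambda>U. U \<subseteq> f ` topspace T \<and> openin T {x \<in> topspace T. f x \<in> U})"

lemma openin_quotient_topology:
  "openin (quotient_topology T f) U \<longleftrightarrow>
     U \<subseteq> f ` topspace T \<and> openin T {x \<in> topspace T. f x \<in> U}"
proof -
  have "istopology (\<lambda>U. U \<subseteq> f ` topspace T \<and> openin T {x \<in> topspace T. f x \<in> U})"
    unfolding istopology_def
  proof (intro conjI allI impI)
    fix S S' assume a: "S \<subseteq> f ` topspace T \<and> openin T {x \<in> topspace T. f x \<in> S}"
      "S' \<subseteq> f ` topspace T \<and> openin T {x \<in> topspace T. f x \<in> S'}"
    have "{x \<in> topspace T. f x \<in> S \<inter> S'} =
        {x \<in> topspace T. f x \<in> S} \<inter> {x \<in> topspace T. f x \<in> S'}" by blast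
    then show "openin T {x \<in> topspace T. f x \<in> S \<inter> S'}" using a by auto
    show "S \<inter> S' \<subseteq> f ` topspace T" using a by blast
  next
    fix K assume a: "\<forall>S\<in>K. S \<subseteq> f ` topspace T \<and> openin T {x \<in> topspace T. f x \<in> S}"
    have "{x \<in> topspace T. f x \<in> \<Union>K} = (\<Union>S\<in>K. {x \<in> topspace T. f x \<in> S})" by blast
    then show "openin T {x \<in> topspace T. f x \<in> \<Union>K}" using a by auto
    show "\<Union>K \<subseteq> f ` topspace T" using a by blast
  qed
  then show ?thesis by (simp add: quotient_topology_def)
qed

lemma quotient_map_quotient_topology:
  "quotient_map T (quotient_topology T f) f"
proof -
  have "{x \<in> topspace T. f x \<in> f ` topspace T} = topspace T" by blast
  then have "openin (quotient_topology T f) (f ` topspace T)"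
    by (simp add: openin_quotient_topology)
  then have "topspace (quotient_topology T f) = f ` topspace T"
    by (metis openin_quotient_topology openin_subset openin_topspace subset_antisym)
  then show ?thesis
    by (auto simp: quotient_map_def openin_quotient_topology)
qed

section \<open>Projective space and projective varieties\<close>

type_synonym point = "(nat \<Rightarrow> complex) set"
type_synonym 'v cpoly = "('v \<Rightarrow>\<^sub>0 nat) \<Rightarrow>\<^sub>0 complex"

definition line :: "('v \<Rightarrow> complex) \<Rightarrow> ('v \<Rightarrow> complex) set" where
  "line v = {(\<lambda>i. c * v i) | c. c \<noteq> 0}"

definition vecs :: "nat \<Rightarrow> (nat \<Rightarrow> complex) set" where
  "vecs N = {v. \<forall>i>N. v i = 0}"

definition pspace :: "nat \<Rightarrow> point set" where
  "pspace N = line ` (vecs N - {0})"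

definition pspace_topology :: "nat \<Rightarrow> point topology" where
  "pspace_topology N = quotient_topology (top_of_set (vecs N - {0})) line"

definition peval :: "'v cpoly \<Rightarrow> ('v \<Rightarrow> complex) \<Rightarrow> complex" where
  "peval F v = (\<Sum>m\<in>Poly_Mapping.keys F. Poly_Mapping.lookup F m *
     (\<Prod>i\<in>Poly_Mapping.keys m. v i ^ Poly_Mapping.lookup m i))"

definition pvars :: "'v cpoly \<Rightarrow> 'v set" where
  "pvars F = (\<Union>m\<in>Poly_Mapping.keys F. Poly_Mapping.keys m)"

definition forms :: "nat \<Rightarrow> nat cpoly set" where
  "forms N = {F. pvars F \<subseteq> {..N} \<and>
     (\<exists>d. \<forall>m\<in>Poly_Mapping.keys F. (\<Sum>i\<in>Poly_Mapping.keys m. Poly_Mapping.lookup m i) = d)}"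

definition zero_set :: "nat \<Rightarrow> nat cpoly set \<Rightarrow> point set" where
  "zero_set N S = {L \<in> pspace N. \<forall>F\<in>S. \<forall>v\<in>L. peval F v = 0}"

definition zclosed :: "nat \<Rightarrow> point set \<Rightarrow> bool" where
  "zclosed N Z \<longleftrightarrow> (\<exists>S\<subseteq>forms N. Z = zero_set N S)"

definition real_zclosed :: "nat \<Rightarrow> point set \<Rightarrow> bool" where
  "real_zclosed N Z \<longleftrightarrow>
     (\<exists>S\<subseteq>forms N. (\<forall>F\<in>S. \<forall>m. Poly_Mapping.lookup F m \<in> \<real>) \<and> Z = zero_set N S)"

definition irreducible_closed :: "nat \<Rightarrow> point set \<Rightarrow> bool" where
  "irreducible_closed N V \<longleftrightarrow> zclosed N V \<and> V \<noteq> {} \<and>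
     (\<forall>A B. zclosed N A \<and> zclosed N B \<and> V = A \<union> B \<longrightarrow> V = A \<or> V = B)"

definition irreducible_chain :: "nat \<Rightarrow> (nat \<Rightarrow> point set) \<Rightarrow> nat \<Rightarrow> point set \<Rightarrow> bool" where
  "irreducible_chain N W k Z \<longleftrightarrow>
     (\<forall>i\<le>k. irreducible_closed N (W i) \<and> W i \<subseteq> Z) \<and> (\<forall>i<k. W i \<subset> W (Suc i))"

definition zdim :: "nat \<Rightarrow> point set \<Rightarrow> enat" where
  "zdim N Z = (SUP k\<in>{k. \<exists>W. irreducible_chain N W k Z}. enat k)"

text \<open>The Krull dimension of the local ring of \<open>Z\<close> at its closed point \<open>L\<close>.\<close>

definition local_dim :: "nat \<Rightarrow> point set \<Rightarrow> point \<Rightarrow> enat" where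
  "local_dim N Z L = (SUP k\<in>{k. \<exists>W. irreducible_chain N W k Z \<and> L \<in> W 0}. enat k)"

text \<open>
  The Zariski tangent space of the affine cone over \<open>Z\<close> at a nonzero vector \<open>v\<close>; its dimension
  is one more than that of the tangent space of \<open>Z\<close> at the point \<open>line v\<close>. For \<open>Z\<close> defined over
  the reals, smoothness over the reals is regularity of the complexification.
\<close>

definition cone_tangent_space :: "nat \<Rightarrow> point set \<Rightarrow> (nat \<Rightarrow> complex) \<Rightarrow> (nat \<Rightarrow> complex) set" where
  "cone_tangent_space N Z v = {w \<in> vecs N. \<forall>F\<in>forms N. (\<forall>L\<in>Z. \<forall>u\<in>L. peval F u = 0) \<longrightarrow>
     deriv (\<lambda>z. peval F (\<lambda>i. v i + z * w i)) 0 = 0}"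

definition smooth :: "nat \<Rightarrow> point set \<Rightarrow> bool" where
  "smooth N Z \<longleftrightarrow> (\<forall>L\<in>Z. \<forall>v\<in>L.
     enat (vector_space.dim (\<lambda>c u i. c * u i) (cone_tangent_space N Z v)) = local_dim N Z L + 1)"

definition smooth_projective_real_variety :: "nat \<Rightarrow> point set \<Rightarrow> bool" where
  "smooth_projective_real_variety N X \<longleftrightarrow> real_zclosed N X \<and> smooth N X"

definition real_points :: "point set \<Rightarrow> point set" where
  "real_points Z = {L \<in> Z. \<exists>v\<in>L. \<forall>i. v i \<in> \<real>}"

definition real_locus :: "nat \<Rightarrow> point set \<Rightarrow> point topology" where
  "real_locus N Z = subtopology (pspace_topology N) (real_points Z)"

text \<open>
  Products are formed through the Segre embedding of \<open>\<P>\<^sup>N \<times> \<P>\<^sup>1\<close> into \<open>\<P>\<^sup>2\<^sup>N\<^sup>+\<^sup>1\<close>, the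
  coordinate with index \<open>2 i + j\<close> being \<open>x\<^sub>i y\<^sub>j\<close>.
\<close>

definition segre :: "point \<Rightarrow> point \<Rightarrow> point" where
  "segre L M = {(\<lambda>k. x (k div 2) * y (k mod 2)) | x y. x \<in> L \<and> y \<in> M}"

definition segre_prod :: "point set \<Rightarrow> point set \<Rightarrow> point set" where
  "segre_prod V W = {segre L M | L M. L \<in> V \<and> M \<in> W}"

section \<open>Chow monoids and cycle groups\<close>

type_synonym cycle = "point set \<Rightarrow>\<^sub>0 int"

definition subvarieties :: "nat \<Rightarrow> nat \<Rightarrow> point set \<Rightarrow> point set set" where
  "subvarieties N q Y = {V. irreducible_closed N V \<and> zdim N V = enat q \<and> V \<subseteq> Y}"

definition cycle_group :: "nat \<Rightarrow> nat \<Rightarrow> point set \<Rightarrow> cycle monoid" where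
  "cycle_group N q Y = free_Abelian_group (subvarieties N q Y)"

definition effective_cycles :: "nat \<Rightarrow> nat \<Rightarrow> point set \<Rightarrow> cycle set" where
  "effective_cycles N q Y =
     {Z \<in> carrier (cycle_group N q Y). \<forall>V. Poly_Mapping.lookup Z V \<ge> 0}"

text \<open>
  The Chow form of an irreducible \<open>V\<close> of dimension \<open>q\<close> is the irreducible equation, unique up to
  a nonzero scalar, of the hypersurface of those \<open>(q+1)\<close>-tuples of linear forms
  \<open>u\<^sub>j = \<Sum>\<^sub>i u (j, i) x\<^sub>i\<close> that have a common zero on \<open>V\<close>.
\<close>

definition is_chow_form :: "nat \<Rightarrow> nat \<Rightarrow> point set \<Rightarrow> (nat \<times> nat) cpoly \<Rightarrow> bool" where
  "is_chow_form N q V F \<longleftrightarrow> irreducible F \<and> pvars F \<subseteq> {..q} \<times> {..N} \<and>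
     (\<forall>u. peval F u = 0 \<longleftrightarrow> (\<exists>L\<in>V. \<forall>x\<in>L. \<forall>j\<le>q. (\<Sum>i\<le>N. u (j, i) * x i) = 0))"

definition chow_form :: "nat \<Rightarrow> nat \<Rightarrow> point set \<Rightarrow> (nat \<times> nat) cpoly" where
  "chow_form N q V = (SOME F. is_chow_form N q V F)"

definition chow_point :: "nat \<Rightarrow> nat \<Rightarrow> cycle \<Rightarrow> ((nat \<times> nat \<Rightarrow>\<^sub>0 nat) \<Rightarrow> complex) set" where
  "chow_point N q Z = line (Poly_Mapping.lookup
     (\<Prod>V\<in>Poly_Mapping.keys Z. chow_form N q V ^ nat (Poly_Mapping.lookup Z V)))"

text \<open>
  The Chow variety of effective \<open>q\<close>-cycles of degree \<open>d\<close>, with its analytic topology, is a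
  subspace of the projective space of forms of degree \<open>(q+1) d\<close>. All \<open>d\<close> are treated at once
  by using coefficient families on all monomials: being of degree \<open>(q+1) d\<close> is, for nonzero
  homogeneous forms, the nonvanishing of some coefficient of that degree, so the pieces for
  different \<open>d\<close> are open, and the Chow monoid is their disjoint union.
\<close>

definition chow_monoid_topology :: "nat \<Rightarrow> nat \<Rightarrow> point set \<Rightarrow> cycle topology" where
  "chow_monoid_topology N q Y = pullback_topology (effective_cycles N q Y) (chow_point N q)
     (quotient_topology (top_of_set (- {0})) line)"

text \<open>The group completion, with the quotient topology of \<open>(a, b) \<mapsto> a - b\<close>.\<close>

definition cycle_topology :: "nat \<Rightarrow> nat \<Rightarrow> point set \<Rightarrow> cycle topology" where
  "cycle_topology N q Y = quotient_topology
     (prod_topology (chow_monoid_topology N q Y) (chow_monoid_topology N q Y)) (\<lambda>(a, b). a - b)"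

section \<open>Reduced cycle groups of quasi-projective real varieties\<close>

text \<open>
  A quasi-projective real variety \<open>U\<close> is given by a projectivization \<open>pcl U\<close>, closed in
  projective space of dimension \<open>amb U\<close>, and the closed complement \<open>bdry U\<close> of \<open>U\<close> in it.
\<close>

record qpvar =
  amb :: nat
  pcl :: "point set"
  bdry :: "point set"

definition proj_var :: "nat \<Rightarrow> point set \<Rightarrow> qpvar" where
  "proj_var N X = \<lparr>amb = N, pcl = X, bdry = {}\<rparr>"

definition infty :: point where
  "infty = line (\<lambda>i. if i = 1 then 1 else 0)"

definition affine_line :: qpvar where
  "affine_line = \<lparr>amb = 1, pcl = pspace 1, bdry = {infty}\<rparr>"

definition times_A1 :: "qpvar \<Rightarrow> qpvar" where
  "times_A1 U = \<lparr>amb = 2 * amb U + 1, pcl = segre_prod (pcl U) (pspace 1),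
     bdry = segre_prod (bdry U) (pspace 1) \<union> segre_prod (pcl U) {infty}\<rparr>"

definition closure_group :: "qpvar \<Rightarrow> nat \<Rightarrow> cycle monoid" where
  "closure_group U q = cycle_group (amb U) q (pcl U)"

definition boundary_cycles :: "qpvar \<Rightarrow> nat \<Rightarrow> cycle set" where
  "boundary_cycles U q = carrier (cycle_group (amb U) q (bdry U))"

definition Z_group :: "qpvar \<Rightarrow> nat \<Rightarrow> cycle set monoid" where
  "Z_group U q = closure_group U q Mod boundary_cycles U q"

definition Z_class :: "qpvar \<Rightarrow> nat \<Rightarrow> cycle \<Rightarrow> cycle set" where
  "Z_class U q c = boundary_cycles U q #>\<^bsub>closure_group U q\<^esub> c"

definition Z_topology :: "qpvar \<Rightarrow> nat \<Rightarrow> cycle set topology" where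
  "Z_topology U q = quotient_topology (cycle_topology (amb U) q (pcl U)) (Z_class U q)"

definition conj_variety :: "point set \<Rightarrow> point set" where
  "conj_variety V = (\<lambda>L. (\<lambda>v i. cnj (v i)) ` L) ` V"

definition conj_cycle :: "cycle \<Rightarrow> cycle" where
  "conj_cycle = frag_extend (\<lambda>V. frag_of (conj_variety V))"

definition invariant_cycles :: "qpvar \<Rightarrow> nat \<Rightarrow> cycle set set" where
  "invariant_cycles U q = {A \<in> carrier (Z_group U q). conj_cycle ` A = A}"

definition averaged_cycles :: "qpvar \<Rightarrow> nat \<Rightarrow> cycle set set" where
  "averaged_cycles U q = generate (Z_group U q)
     {A \<otimes>\<^bsub>Z_group U q\<^esub> conj_cycle ` A | A. A \<in> carrier (Z_group U q)}"

definition R_group :: "qpvar \<Rightarrow> nat \<Rightarrow> cycle set set monoid" where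
  "R_group U q = ((Z_group U q)\<lparr>carrier := invariant_cycles U q\<rparr>) Mod averaged_cycles U q"

definition R_class :: "qpvar \<Rightarrow> nat \<Rightarrow> cycle set \<Rightarrow> cycle set set" where
  "R_class U q A = averaged_cycles U q #>\<^bsub>Z_group U q\<^esub> A"

definition R_topology :: "qpvar \<Rightarrow> nat \<Rightarrow> cycle set set topology" where
  "R_topology U q =
     quotient_topology (subtopology (Z_topology U q) (invariant_cycles U q)) (R_class U q)"

section \<open>Homotopy groups\<close>

text \<open>
  The underlying set of the \<open>n\<close>-th homotopy group, as homotopy classes of maps of the
  \<open>n\<close>-cube sending the boundary to the base point.
\<close>

definition cube :: "nat \<Rightarrow> (nat \<Rightarrow> real) set" where
  "cube n = {t. (\<forall>i<n. 0 \<le> t i \<and> t i \<le> 1) \<and> (\<forall>i\<ge>n. t i = 0)}"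

definition cube_boundary :: "nat \<Rightarrow> (nat \<Rightarrow> real) set" where
  "cube_boundary n = {t \<in> cube n. \<exists>i<n. t i = 0 \<or> t i = 1}"

definition spheroid :: "nat \<Rightarrow> 'a topology \<Rightarrow> 'a \<Rightarrow> ((nat \<Rightarrow> real) \<Rightarrow> 'a) \<Rightarrow> bool" where
  "spheroid n T b f \<longleftrightarrow>
     continuous_map (top_of_set (cube n)) T f \<and> (\<forall>t\<in>cube_boundary n. f t = b)"

definition homotopy_class ::
    "nat \<Rightarrow> 'a topology \<Rightarrow> 'a \<Rightarrow> ((nat \<Rightarrow> real) \<Rightarrow> 'a) \<Rightarrow> ((nat \<Rightarrow> real) \<Rightarrow> 'a) set" where
  "homotopy_class n T b f =
     {g. homotopic_with (\<lambda>h. \<forall>t\<in>cube_boundary n. h t = b) (top_of_set (cube n)) T f g}"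

definition homotopy_group :: "nat \<Rightarrow> 'a topology \<Rightarrow> 'a \<Rightarrow> ((nat \<Rightarrow> real) \<Rightarrow> 'a) set set" where
  "homotopy_group n T b = {homotopy_class n T b f | f. spheroid n T b f}"

type_synonym R_spheroid = "(nat \<Rightarrow> real) \<Rightarrow> cycle set set"

definition pi_R :: "nat \<Rightarrow> qpvar \<Rightarrow> nat \<Rightarrow> R_spheroid set set" where
  "pi_R i U q = homotopy_group i (R_topology U q) \<one>\<^bsub>R_group U q\<^esub>"

definition pi_R_class :: "nat \<Rightarrow> qpvar \<Rightarrow> nat \<Rightarrow> R_spheroid \<Rightarrow> R_spheroid set" where
  "pi_R_class i U q f = homotopy_class i (R_topology U q) \<one>\<^bsub>R_group U q\<^esub> f"

definition RLH :: "nat \<Rightarrow> nat \<Rightarrow> qpvar \<Rightarrow> R_spheroid set set" where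
  "RLH q n U = pi_R (n - q) U q"

section \<open>The s-map\<close>

text \<open>
  A map of cycle groups compatible with the subgroups divided out induces a map of the quotients:
  the coset \<open>A\<close> goes to the product of the image of \<open>A\<close> with the target subgroup.
\<close>

definition ext_cycle :: "cycle \<Rightarrow> cycle \<Rightarrow> cycle" where
  "ext_cycle a b = frag_extend (\<lambda>V. frag_extend (\<lambda>W. frag_of (segre_prod V W)) b) a"

definition ext_Z :: "qpvar \<Rightarrow> nat \<Rightarrow> cycle set \<Rightarrow> cycle set \<Rightarrow> cycle set" where
  "ext_Z U q A B = boundary_cycles (times_A1 U) q <#>\<^bsub>closure_group (times_A1 U) q\<^esub>
     {ext_cycle a b | a b. a \<in> A \<and> b \<in> B}"

definition ext_R :: "qpvar \<Rightarrow> nat \<Rightarrow> cycle set set \<Rightarrow> cycle set set \<Rightarrow> cycle set set" where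
  "ext_R U q \<A> \<B> = averaged_cycles (times_A1 U) q <#>\<^bsub>Z_group (times_A1 U) q\<^esub>
     {ext_Z U q A B | A B. A \<in> \<A> \<and> B \<in> \<B>}"

definition pull_cycle :: "cycle \<Rightarrow> cycle" where
  "pull_cycle = frag_extend (\<lambda>V. frag_of (segre_prod V (pspace 1)))"

definition pull_Z :: "qpvar \<Rightarrow> nat \<Rightarrow> cycle set \<Rightarrow> cycle set" where
  "pull_Z U q A = boundary_cycles (times_A1 U) (Suc q)
     <#>\<^bsub>closure_group (times_A1 U) (Suc q)\<^esub> (pull_cycle ` A)"

definition pull_R :: "qpvar \<Rightarrow> nat \<Rightarrow> cycle set set \<Rightarrow> cycle set set" where
  "pull_R U q \<A> = averaged_cycles (times_A1 U) (Suc q)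
     <#>\<^bsub>Z_group (times_A1 U) (Suc q)\<^esub> (pull_Z U q ` \<A>)"

definition pull_pi :: "nat \<Rightarrow> qpvar \<Rightarrow> nat \<Rightarrow> R_spheroid set \<Rightarrow> R_spheroid set" where
  "pull_pi i U q \<beta> = (\<Union>f\<in>\<beta>. pi_R_class i (times_A1 U) (Suc q) (pull_R U q \<circ> f))"

text \<open>
  The generator of \<open>\<pi>\<^sub>1 \<R>\<^sub>0(\<A>\<^sup>1) = \<int>/2\<close>: the point running once around the real projective line,
  starting and ending at infinity (whose class is the base point).
\<close>

definition A1_loop :: R_spheroid where
  "A1_loop t = R_class affine_line 0 (Z_class affine_line 0 (frag_of {line (\<lambda>i.
     if i = 0 then complex_of_real (sin (pi * t 0))
     else if i = 1 then complex_of_real (cos (pi * t 0)) else 0)}))"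

definition A1_generator :: "R_spheroid set" where
  "A1_generator = pi_R_class 1 affine_line 0 A1_loop"

definition smash_pi :: "nat \<Rightarrow> qpvar \<Rightarrow> nat \<Rightarrow> R_spheroid set \<Rightarrow> R_spheroid set \<Rightarrow> R_spheroid set" where
  "smash_pi i U q \<alpha> \<gamma> = (\<Union>f\<in>\<alpha>. \<Union>g\<in>\<gamma>. pi_R_class (Suc i) (times_A1 U) q
     (\<lambda>t. ext_R U q (f (\<lambda>k. if k < i then t k else 0)) (g (\<lambda>k. if k = 0 then t i else 0))))"

text \<open>
  \<open>s_map U q n\<close> goes from \<^term>\<open>RLH (Suc q) n U\<close> to \<^term>\<open>RLH q n U\<close>, for \<open>Suc q \<le> n\<close>.
\<close>

definition s_map :: "qpvar \<Rightarrow> nat \<Rightarrow> nat \<Rightarrow> R_spheroid set \<Rightarrow> R_spheroid set" where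
  "s_map U q n \<alpha> = the_inv_into (RLH q n U) (pull_pi (n - q) U q)
     (smash_pi (n - Suc q) U (Suc q) \<alpha> A1_generator)"

primrec s_iterate :: "qpvar \<Rightarrow> nat \<Rightarrow> nat \<Rightarrow> R_spheroid set \<Rightarrow> R_spheroid set" where
  "s_iterate U 0 n \<alpha> = \<alpha>"
| "s_iterate U (Suc q) n \<alpha> = s_iterate U q n (s_map U q n \<alpha>)"

section \<open>Singular homology with coefficients in Z/2\<close>

text \<open>
  The homology of the singular chain complex tensored with \<open>\<int>/2\<close>, written as subquotients of the
  integral chain groups. On the compact real loci of projective varieties it is the same as
  Borel--Moore homology.
\<close>

definition mod2_cycles :: "nat \<Rightarrow> 'a topology \<Rightarrow> 'a chain set" where
  "mod2_cycles n T = {c. singular_chain n T c \<and>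
     (\<exists>e. singular_chain (n - 1) T e \<and> chain_boundary n c = frag_cmul 2 e)}"

definition mod2_boundaries :: "nat \<Rightarrow> 'a topology \<Rightarrow> 'a chain set" where
  "mod2_boundaries n T = {chain_boundary (Suc n) d + frag_cmul 2 e | d e.
     singular_chain (Suc n) T d \<and> singular_chain n T e}"

definition mod2_homology_group :: "nat \<Rightarrow> 'a topology \<Rightarrow> 'a chain set monoid" where
  "mod2_homology_group n T =
     subgroup_generated (chain_group n T) (mod2_cycles n T) Mod mod2_boundaries n T"

definition mod2_hom_induced ::
    "nat \<Rightarrow> 'a topology \<Rightarrow> 'b topology \<Rightarrow> ('a \<Rightarrow> 'b) \<Rightarrow> 'a chain set \<Rightarrow> 'b chain set" where
  "mod2_hom_induced n S T f A =
     mod2_boundaries n T <#>\<^bsub>chain_group n T\<^esub> (chain_map n f ` A)"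

definition real_homology :: "nat \<Rightarrow> nat \<Rightarrow> point set \<Rightarrow> point chain set monoid" where
  "real_homology n N X = mod2_homology_group n (real_locus N X)"

definition niveau :: "nat \<Rightarrow> nat \<Rightarrow> nat \<Rightarrow> point set \<Rightarrow> point chain set set" where
  "niveau p n N X = generate (real_homology n N X)
     (\<Union>V\<in>{V. real_zclosed N V \<and> V \<subseteq> X \<and> zdim N V \<le> enat p}.
        mod2_hom_induced n (real_locus N V) (real_locus N X) id ` carrier (real_homology n N V))"

section \<open>The Dold--Thom isomorphism and the cycle map\<close>

text \<open>
  The Dold--Thom isomorphism from \<open>H\<^sub>n(X(\<real>); \<int>/2)\<close> to \<open>\<pi>\<^sub>n \<R>\<^sub>0(X)\<close>, in its simplicial form: by
  Moore's normalization theorem every mod 2 homology class is represented by a chain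
  \<open>c = \<Sum> c\<^sub>\<sigma> \<sigma>\<close> all of whose faces vanish mod 2, and then \<open>x \<mapsto> \<Sum> c\<^sub>\<sigma> \<sigma>(x)\<close> maps the boundary of
  the simplex to the zero cycle. The map \<open>cube_to_simplex n\<close>, which induces a homeomorphism
  of the cube modulo its boundary onto the simplex modulo its boundary, turns it into a map on
  the cube. (Orientations are irrelevant as all groups have exponent 2.)
\<close>

definition mod2_normalized :: "nat \<Rightarrow> 'a topology \<Rightarrow> 'a chain \<Rightarrow> bool" where
  "mod2_normalized n T c \<longleftrightarrow> singular_chain n T c \<and> (n > 0 \<longrightarrow> (\<forall>k\<le>n. \<exists>e.
     singular_chain (n - 1) T e \<and>
     frag_extend (\<lambda>\<sigma>. frag_of (singular_face n k \<sigma>)) c = frag_cmul 2 e))"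

definition cube_to_simplex :: "nat \<Rightarrow> (nat \<Rightarrow> real) \<Rightarrow> (nat \<Rightarrow> real)" where
  "cube_to_simplex n t k =
     (if k < n then t k * (\<Prod>j<k. 1 - t j) else if k = n then (\<Prod>j<n. 1 - t j) else 0)"

definition dold_thom_spheroid :: "nat \<Rightarrow> qpvar \<Rightarrow> point chain \<Rightarrow> R_spheroid" where
  "dold_thom_spheroid n U c t = R_class U 0 (Z_class U 0
     (frag_extend (\<lambda>\<sigma>. frag_of {\<sigma> (cube_to_simplex n t)}) c))"

definition dold_thom :: "nat \<Rightarrow> nat \<Rightarrow> point set \<Rightarrow> point chain set \<Rightarrow> R_spheroid set" where
  "dold_thom n N X h = pi_R_class n (proj_var N X) 0
     (dold_thom_spheroid n (proj_var N X) (SOME c. c \<in> h \<and> mod2_normalized n (real_locus N X) c))"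

definition cyc :: "nat \<Rightarrow> nat \<Rightarrow> nat \<Rightarrow> point set \<Rightarrow> R_spheroid set \<Rightarrow> point chain set" where
  "cyc q n N X \<alpha> = the_inv_into (carrier (real_homology n N X)) (dold_thom n N X)
     (s_iterate (proj_var N X) q n \<alpha>)"

end

theory Submission
  imports Defs "HOL-Complex_Analysis.Winding_Numbers" "HOL-Computational_Algebra.Polynomial"
begin

text \<open>
  The equality already fails for \<open>q = n = 1\<close> on a real curve with two ovals. Let \<open>X\<close> be a smooth
  projective real curve that is irreducible over the complex numbers. The only one-dimensional
  subvariety of \<open>X\<close> is \<open>X\<close> itself, so \<open>\<Z>\<^sub>1(X) = \<int> \<cdot> X\<close>, the averaged cycles are \<open>2\<int> \<cdot> X\<close>, and
  \<open>\<R>\<^sub>1(X)\<close> has two elements. Hence \<open>RL\<^sub>1H\<^sub>1(X) = \<pi>\<^sub>0 \<R>\<^sub>1(X)\<close> has at most two elements, and so has the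
  image of the cycle map, whatever its values are: geometrically, it only sees the fundamental class
  of the whole real locus. The group \<open>N\<^sub>1H\<^sub>1\<close>, on the other hand, is all of \<open>H\<^sub>1(X(\<real>); \<int>/2)\<close>, since
  \<open>X\<close> itself is one of the subvarieties of dimension at most one. It contains the class of every
  single connected component of \<open>X(\<real>)\<close>, so two ovals give at least three elements.

  The curve used is the elliptic curve \<open>x\<^sub>1\<^sup>2 + x\<^sub>2\<^sup>2 = x\<^sub>0\<^sup>2\<close>, \<open>x\<^sub>3\<^sup>2 = x\<^sub>0\<^sup>2 + x\<^sub>1\<^sup>2\<close> in
  \<open>\<P>\<^sup>3\<close>. Its real points lie over the circle \<open>(x\<^sub>1/x\<^sub>0, x\<^sub>2/x\<^sub>0)\<close> with \<open>x\<^sub>3/x\<^sub>0\<close> one of the two nonzero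
  square roots of a positive function; the sign of \<open>x\<^sub>3/x\<^sub>0\<close> distinguishes two ovals, each of which
  projects homeomorphically to the circle. Three facts remain.

  \<^item> Every proper closed subset of the curve is finite (\<open>cofinite_two_oval_curve\<close>). The conic is
    rational, and the curve is the double cover \<open>y\<^sup>2 = h(s)\<close> of it, where \<open>h\<close> has a simple root. On
    it a form becomes \<open>A(s) + y B(s)\<close>, whose zeros satisfy \<open>A\<^sup>2 = h B\<^sup>2\<close>; this is a nontrivial equation
    for \<open>s\<close>, by the parity of the order at the simple root, unless \<open>A = B = 0\<close>. Irreducibility and
    all dimensions follow formally.

  \<^item> The curve is smooth (\<open>smooth_two_oval_curve\<close>). The tangent space of the cone lies in the kernel
    of the differentials of the two equations, which is a plane, and every vector of that plane is
    the velocity of an explicit holomorphic arc in the cone built from square roots.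

  \<^item> The classes \<open>0\<close> and those of the two ovals are distinct (\<open>niveau_has_three_elements\<close>). For a map
    from the real locus to the punctured plane the total winding number of a singular 1-chain
    vanishes on boundaries and is an integer on cycles, so it is even on a cycle that is a boundary
    modulo 2. The projection of one oval to the circle, extended by a constant to the other oval, has
    winding numbers 1 and 0 on them.
\<close>

section \<open>Evaluating forms\<close>

lemma peval_superset:
  assumes "finite M" "Poly_Mapping.keys F \<subseteq> M"
  shows "peval F v = (\<Sum>m\<in>M. Poly_Mapping.lookup F m *
     (\<Prod>i\<in>Poly_Mapping.keys m. v i ^ Poly_Mapping.lookup m i))"
  unfolding peval_def using assms
  by (intro sum.mono_neutral_left) (auto simp: in_keys_iff)

lemma peval_add: "peval (F + G) v = peval F v + peval G v"
proof -
  let ?M = "Poly_Mapping.keys F \<union> Poly_Mapping.keys G"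
  have "peval (F + G) v = (\<Sum>m\<in>?M. Poly_Mapping.lookup (F + G) m *
     (\<Prod>i\<in>Poly_Mapping.keys m. v i ^ Poly_Mapping.lookup m i))"
    by (rule peval_superset) (auto dest: subsetD [OF keys_add])
  then show ?thesis
    by (simp add: peval_superset [of ?M F] peval_superset [of ?M G] lookup_add ring_distribs
        sum.distrib)
qed

lemma peval_monomial:
  "peval (Poly_Mapping.single m a) v = a * (\<Prod>i\<in>Poly_Mapping.keys m. v i ^ Poly_Mapping.lookup m i)"
  by (subst peval_superset [of "{m}"]) auto

lemma peval_homogeneous:
  assumes "F \<in> forms N"
  obtains d where "\<And>c v. peval F (\<lambda>i. c * v i) = c ^ d * peval F v"
proof -
  obtain d where d: "\<And>m. m \<in> Poly_Mapping.keys F \<Longrightarrow>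
      (\<Sum>i\<in>Poly_Mapping.keys m. Poly_Mapping.lookup m i) = d"
    using assms by (auto simp: forms_def)
  have "peval F (\<lambda>i. c * v i) = c ^ d * peval F v" for c v
    unfolding peval_def sum_distrib_left
    by (intro sum.cong refl)
      (simp add: power_mult_distrib prod.distrib power_sum [symmetric] d)
  then show thesis using that by blast
qed

lemma peval_form_scale:
  assumes "F \<in> forms N" "c \<noteq> 0"
  shows "peval F (\<lambda>i. c * v i) = 0 \<longleftrightarrow> peval F v = 0"
  using peval_homogeneous [OF assms(1)] assms(2) by (metis mult_eq_0_iff power_not_zero)

definition power_term :: "complex \<Rightarrow> nat \<Rightarrow> nat \<Rightarrow> nat cpoly" where
  "power_term a e i = Poly_Mapping.single (Poly_Mapping.single i e) a"

lemma peval_power_term: "e > 0 \<Longrightarrow> peval (power_term a e i) v = a * v i ^ e"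
  by (simp add: power_term_def peval_monomial)

lemma power_term_in_keysD:
  assumes "m \<in> Poly_Mapping.keys (power_term a e i)" "e > 0"
  shows "Poly_Mapping.keys m = {i} \<and> (\<Sum>j\<in>Poly_Mapping.keys m. Poly_Mapping.lookup m j) = e"
  using assms by (cases "a = 0") (auto simp: power_term_def)

text \<open>
  Sums of pure powers are the only forms that have to be written down: linear forms cut out points,
  and the curve below is the intersection of two diagonal quadrics.
\<close>

lemma sum_power_terms_in_forms:
  assumes "e > 0" "finite I" "I \<subseteq> {..N}"
  shows "(\<Sum>i\<in>I. power_term (a i) e i) \<in> forms N"
proof -
  have "\<exists>i\<in>I. m \<in> Poly_Mapping.keys (power_term (a i) e i)"
    if "m \<in> Poly_Mapping.keys (\<Sum>i\<in>I. power_term (a i) e i)" for m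
    using that keys_sum [of "\<lambda>i. power_term (a i) e i" I] by blast
  then have "\<exists>i\<in>I. Poly_Mapping.keys m = {i} \<and> (\<Sum>j\<in>Poly_Mapping.keys m. Poly_Mapping.lookup m j) = e"
    if "m \<in> Poly_Mapping.keys (\<Sum>i\<in>I. power_term (a i) e i)" for m
    using that power_term_in_keysD assms(1) by blast
  then show ?thesis
    using assms(3) unfolding forms_def pvars_def by fastforce
qed

lemma peval_0 [simp]: "peval 0 v = 0"
  by (simp add: peval_def)

lemma peval_sum: "peval (\<Sum>i\<in>I. F i) v = (\<Sum>i\<in>I. peval (F i) v)"
  by (induction I rule: infinite_finite_induct) (auto simp: peval_add)

lemma peval_sum_power_terms:
  "e > 0 \<Longrightarrow> peval (\<Sum>i\<in>I. power_term (a i) e i) v = (\<Sum>i\<in>I. a i * v i ^ e)"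
  by (simp add: peval_sum peval_power_term)

lemma real_sum_power_terms:
  assumes "\<And>i. i \<in> I \<Longrightarrow> a i \<in> \<real>"
  shows "Poly_Mapping.lookup (\<Sum>i\<in>I. power_term (a i) e i) m \<in> \<real>"
  using assms by (auto simp: lookup_sum power_term_def lookup_single when_def intro!: sum_in_Reals)

text \<open>
  Along an arc through \<open>v\<close> with velocity \<open>w\<close>, the derivative of a polynomial is the same number for
  all arcs: the chain rule, without naming the partial derivatives.
\<close>

lemma peval_curve_derivative:
  fixes F :: "nat cpoly"
  shows "\<exists>D. \<forall>\<gamma>. (\<forall>i. \<gamma> i 0 = v i \<and> (\<gamma> i has_field_derivative w i) (at 0)) \<longrightarrow>
     ((\<lambda>z. peval F (\<lambda>i. \<gamma> i z)) has_field_derivative D) (at 0)"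
proof -
  have pow: "\<exists>D. \<forall>\<gamma>. (\<forall>i. \<gamma> i 0 = v i \<and> (\<gamma> i has_field_derivative w i) (at 0)) \<longrightarrow>
     ((\<lambda>z. \<Prod>i\<in>I. \<gamma> i z ^ k i) has_field_derivative D) (at 0)" if "finite I"
    for I and k :: "nat \<Rightarrow> nat"
    using that
  proof (induction I)
    case empty
    then show ?case by (auto intro!: exI [of _ 0])
  next
    case (insert j I)
    then obtain D where D: "\<And>\<gamma>. (\<forall>i. \<gamma> i 0 = v i \<and> (\<gamma> i has_field_derivative w i) (at 0)) \<Longrightarrow>
     ((\<lambda>z. \<Prod>i\<in>I. \<gamma> i z ^ k i) has_field_derivative D) (at 0)" by blast
    have "((\<lambda>z. \<Prod>i\<in>insert j I. \<gamma> i z ^ k i) has_field_derivative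
        (of_nat (k j) * (v j ^ (k j - 1) * w j)) * (\<Prod>i\<in>I. v i ^ k i) + D * v j ^ k j) (at 0)"
      if g: "\<forall>i. \<gamma> i 0 = v i \<and> (\<gamma> i has_field_derivative w i) (at 0)" for \<gamma>
    proof -
      have "((\<lambda>z. \<gamma> j z ^ k j) has_field_derivative of_nat (k j) * (v j ^ (k j - 1) * w j)) (at 0)"
        using g by (auto intro!: derivative_eq_intros)
      from DERIV_mult [OF this D [OF g]] show ?thesis
        using insert.hyps g by simp
    qed
    then show ?case by blast
  qed
  have "\<forall>m. \<exists>D. \<forall>\<gamma>. (\<forall>i. \<gamma> i 0 = v i \<and> (\<gamma> i has_field_derivative w i) (at 0)) \<longrightarrow>
     ((\<lambda>z. \<Prod>i\<in>Poly_Mapping.keys m. \<gamma> i z ^ Poly_Mapping.lookup m i) has_field_derivative D) (at 0)"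
    using pow by simp
  then obtain D where D: "\<And>m \<gamma>. (\<forall>i. \<gamma> i 0 = v i \<and> (\<gamma> i has_field_derivative w i) (at 0)) \<Longrightarrow>
     ((\<lambda>z. \<Prod>i\<in>Poly_Mapping.keys m. \<gamma> i z ^ Poly_Mapping.lookup m i) has_field_derivative D m) (at 0)"
    by (drule_tac choice) blast
  have "((\<lambda>z. \<Sum>m\<in>Poly_Mapping.keys F. Poly_Mapping.lookup F m *
      (\<Prod>i\<in>Poly_Mapping.keys m. \<gamma> i z ^ Poly_Mapping.lookup m i)) has_field_derivative
      (\<Sum>m\<in>Poly_Mapping.keys F. Poly_Mapping.lookup F m * D m)) (at 0)"
    if "\<forall>i. \<gamma> i 0 = v i \<and> (\<gamma> i has_field_derivative w i) (at 0)" for \<gamma>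
    by (rule DERIV_sum, rule DERIV_cmult, rule D [OF that])
  then show ?thesis unfolding peval_def by blast
qed

text \<open>
  A polynomial that vanishes along an arc is killed by the velocity of the arc. This is how vectors
  are shown to be tangent to a cone without determining its homogeneous ideal.
\<close>

lemma deriv_peval_along_curve:
  fixes F :: "nat cpoly"
  assumes "\<And>i. \<gamma> i 0 = v i" "\<And>i. (\<gamma> i has_field_derivative w i) (at 0)"
    and "eventually (\<lambda>z. peval F (\<lambda>i. \<gamma> i z) = 0) (nhds 0)"
  shows "deriv (\<lambda>z. peval F (\<lambda>i. v i + z * w i)) 0 = 0"
proof -
  obtain D where D: "\<And>\<gamma>. (\<forall>i. \<gamma> i 0 = v i \<and> (\<gamma> i has_field_derivative w i) (at 0)) \<Longrightarrow>
     ((\<lambda>z. peval F (\<lambda>i. \<gamma> i z)) has_field_derivative D) (at 0)"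
    using peval_curve_derivative [where F=F and v=v and w=w] by blast
  have "((\<lambda>z. peval F (\<lambda>i. \<gamma> i z)) has_field_derivative D) (at 0)"
    using D assms by blast
  moreover have "((\<lambda>z. peval F (\<lambda>i. \<gamma> i z)) has_field_derivative 0) (at 0)"
    using assms(3) by (subst DERIV_cong_ev [OF refl _ refl, where g = "\<lambda>z. 0"]) auto
  ultimately have "D = 0" using DERIV_unique by blast
  moreover have "((\<lambda>z. peval F (\<lambda>i. v i + z * w i)) has_field_derivative D) (at 0)"
    by (rule D) (auto intro!: derivative_eq_intros)
  ultimately show ?thesis by (simp add: DERIV_imp_deriv)
qed

section \<open>Points\<close>

lemma self_in_line: "v \<in> line v"
  unfolding line_def by (rule CollectI, rule exI [of _ 1]) auto

lemma line_scale: "c \<noteq> 0 \<Longrightarrow> line (\<lambda>i. c * v i) = line v"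
proof (intro equalityI subsetI)
  fix x assume "c \<noteq> 0" "x \<in> line v"
  then obtain d where "d \<noteq> 0" "x = (\<lambda>i. d * v i)" by (auto simp: line_def)
  then have "x = (\<lambda>i. (d / c) * (c * v i))" "d / c \<noteq> 0" using \<open>c \<noteq> 0\<close> by auto
  then show "x \<in> line (\<lambda>i. c * v i)" unfolding line_def by blast
next
  fix x assume "c \<noteq> 0" "x \<in> line (\<lambda>i. c * v i)"
  then obtain d where "d \<noteq> 0" "x = (\<lambda>i. d * (c * v i))" by (auto simp: line_def)
  then have "x = (\<lambda>i. (d * c) * v i)" "d * c \<noteq> 0" using \<open>c \<noteq> 0\<close> by auto
  then show "x \<in> line v" unfolding line_def by blast
qed

lemma line_eq_of_mem: "w \<in> line v \<Longrightarrow> line w = line v"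
  by (auto simp: line_def [of v] line_scale)

lemma line_eq_iff: "line w = line v \<longleftrightarrow> w \<in> line v"
  using line_eq_of_mem self_in_line by metis

lemma pspaceE:
  assumes "L \<in> pspace N"
  obtains v where "v \<in> vecs N" "v \<noteq> 0" "L = line v"
  using assms by (auto simp: pspace_def)

lemma pspace_memD:
  assumes "L \<in> pspace N" "v \<in> L"
  shows "L = line v" "v \<in> vecs N" "v \<noteq> 0"
proof -
  obtain u where u: "u \<in> vecs N" "u \<noteq> 0" "L = line u" using assms(1) by (rule pspaceE)
  then obtain c where c: "c \<noteq> 0" "v = (\<lambda>i. c * u i)" using assms(2) by (auto simp: line_def)
  show "L = line v" unfolding u(3) c(2) by (rule line_scale [OF c(1), symmetric])
  show "v \<in> vecs N" using u c by (simp add: vecs_def)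
  show "v \<noteq> 0"
  proof
    assume "v = 0"
    then have "c * u i = 0" for i using c(2) by (metis zero_fun_apply)
    then have "u = 0" using c(1) by (simp add: fun_eq_iff)
    then show False using u(2) by blast
  qed
qed

lemma form_zero_on_line:
  "F \<in> forms N \<Longrightarrow> (\<forall>u\<in>line v. peval F u = 0) \<longleftrightarrow> peval F v = 0"
  using self_in_line by (auto simp: line_def peval_form_scale)

lemma line_in_zero_set:
  assumes "S \<subseteq> forms N" "v \<in> vecs N" "v \<noteq> 0"
  shows "line v \<in> zero_set N S \<longleftrightarrow> (\<forall>F\<in>S. peval F v = 0)"
  using assms form_zero_on_line unfolding zero_set_def pspace_def by blast

text \<open>
  If \<open>v\<^sub>k \<noteq> 0\<close>, the line through \<open>v\<close> is cut out by the linear forms \<open>v\<^sub>k x\<^sub>i - v\<^sub>i x\<^sub>k\<close>.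
\<close>

lemma zclosed_point:
  assumes "L \<in> pspace N"
  shows "zclosed N {L}"
proof -
  obtain v where v: "v \<in> vecs N" "v \<noteq> 0" "L = line v"
    using assms by (rule pspaceE)
  then obtain k where k: "v k \<noteq> 0" by (auto simp: fun_eq_iff)
  then have "k \<le> N" using v(1) by (auto simp: vecs_def) (meson not_le)
  define A where "A = (\<lambda>i j. if j = i then v k else - v i)"
  define F where "F i = (\<Sum>j\<in>{i,k}. power_term (A i j) 1 j)" for i
  let ?S = "F ` ({..N} - {k})"
  have S: "?S \<subseteq> forms N"
    using \<open>k \<le> N\<close> unfolding F_def by (intro image_subsetI sum_power_terms_in_forms) auto
  have ev: "peval (F i) w = v k * w i - v i * w k" if "i \<noteq> k" for i w
    unfolding F_def using that by (subst peval_sum_power_terms) (auto simp: A_def)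
  have "zero_set N ?S = {L}"
  proof (intro equalityI subsetI)
    fix M assume M: "M \<in> zero_set N ?S"
    then have "M \<in> pspace N" by (simp add: zero_set_def)
    then obtain w where w: "w \<in> vecs N" "w \<noteq> 0" "M = line w" by (rule pspaceE)
    have e: "v k * w i = v i * w k" for i
    proof (cases "i \<le> N \<and> i \<noteq> k")
      case True
      then have "peval (F i) w = 0" using M w S line_in_zero_set by auto
      then show ?thesis using True ev by simp
    next
      case False
      then show ?thesis using v(1) w(1) by (auto simp: vecs_def)
    qed
    then have ww: "w = (\<lambda>i. (w k / v k) * v i)" using k by (auto simp: field_simps)
    have "w k \<noteq> 0"
    proof
      assume "w k = 0"
      then have "w i = 0" for i using e [of i] k by simp
      then show False using w(2) by (simp add: fun_eq_iff)
    qed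
    then have "w k / v k \<noteq> 0" using k by simp
    then show "M \<in> {L}" using ww line_scale v(3) w(3) by (metis singletonI)
  next
    fix M assume "M \<in> {L}"
    then show "M \<in> zero_set N ?S"
      using S v by (auto simp: line_in_zero_set ev)
  qed
  then show ?thesis unfolding zclosed_def using S by blast
qed

lemma irreducible_closed_point: "L \<in> pspace N \<Longrightarrow> irreducible_closed N {L}"
  unfolding irreducible_closed_def using zclosed_point by (auto simp: eq_commute)

lemma zclosed_subset_pspace: "zclosed N Z \<Longrightarrow> Z \<subseteq> pspace N"
  by (auto simp: zclosed_def zero_set_def)

section \<open>Unions of closed sets\<close>

lemma poly_mapping_monomial_induct [case_names zero monomial add]:
  fixes F :: "'a \<Rightarrow>\<^sub>0 'b::comm_monoid_add"
  assumes "P 0" "\<And>m a. P (Poly_Mapping.single m a)" "\<And>F G. P F \<Longrightarrow> P G \<Longrightarrow> P (F + G)"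
  shows "P F"
proof (induction F rule: update_induct)
  case const
  then show ?case by (rule assms(1))
next
  case (update F a b)
  have "Poly_Mapping.update a b F = Poly_Mapping.single a b + F"
    using update(1)
    by (intro poly_mapping_eqI)
       (auto simp: lookup_update lookup_add lookup_single when_def in_keys_iff)
  then show ?case using assms update by simp
qed

lemma peval_mult: "peval (F * G) v = peval F v * peval G v"
proof -
  have mono: "peval (Poly_Mapping.single m a * Poly_Mapping.single n b) v =
      peval (Poly_Mapping.single m a) v * peval (Poly_Mapping.single n b) v" for m n a b
  proof -
    let ?I = "Poly_Mapping.keys m \<union> Poly_Mapping.keys n"
    have ext: "(\<Prod>i\<in>Poly_Mapping.keys p. v i ^ Poly_Mapping.lookup p i) =
        (\<Prod>i\<in>?I. v i ^ Poly_Mapping.lookup p i)" if "Poly_Mapping.keys p \<subseteq> ?I" for p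
      using that by (intro prod.mono_neutral_left) (auto simp: in_keys_iff)
    have "(\<Prod>i\<in>Poly_Mapping.keys (m + n). v i ^ Poly_Mapping.lookup (m + n) i) =
        (\<Prod>i\<in>Poly_Mapping.keys m. v i ^ Poly_Mapping.lookup m i) *
        (\<Prod>i\<in>Poly_Mapping.keys n. v i ^ Poly_Mapping.lookup n i)"
      unfolding ext [OF keys_add] ext [OF Un_upper1] ext [OF Un_upper2]
      by (simp add: lookup_add power_add prod.distrib)
    then show ?thesis by (simp add: mult_single peval_monomial)
  qed
  have "peval (Poly_Mapping.single m a * G) v = peval (Poly_Mapping.single m a) v * peval G v" for m a
    by (induction G rule: poly_mapping_monomial_induct) (simp_all add: mono ring_distribs peval_add)
  then show ?thesis
    by (induction F rule: poly_mapping_monomial_induct) (simp_all add: ring_distribs peval_add)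
qed

lemma mult_in_forms:
  assumes "F \<in> forms N" "G \<in> forms N"
  shows "F * G \<in> forms N"
proof -
  let ?deg = "\<lambda>m::nat \<Rightarrow>\<^sub>0 nat. \<Sum>i\<in>Poly_Mapping.keys m. Poly_Mapping.lookup m i"
  obtain d e where d: "\<And>m. m \<in> Poly_Mapping.keys F \<Longrightarrow> ?deg m = d"
    and e: "\<And>m. m \<in> Poly_Mapping.keys G \<Longrightarrow> ?deg m = e"
    using assms by (auto simp: forms_def)
  have add: "?deg (m + n) = ?deg m + ?deg n" for m n
  proof -
    let ?I = "Poly_Mapping.keys m \<union> Poly_Mapping.keys n"
    have ext: "?deg p = (\<Sum>i\<in>?I. Poly_Mapping.lookup p i)" if "Poly_Mapping.keys p \<subseteq> ?I" for p
      using that by (intro sum.mono_neutral_left) (auto simp: in_keys_iff)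
    show ?thesis
      unfolding ext [OF keys_add] ext [OF Un_upper1] ext [OF Un_upper2]
      by (simp add: lookup_add sum.distrib)
  qed
  have "?deg p = d + e \<and> Poly_Mapping.keys p \<subseteq> {..N}" if pk: "p \<in> Poly_Mapping.keys (F * G)" for p
  proof -
    obtain m n where p: "p = m + n" "m \<in> Poly_Mapping.keys F" "n \<in> Poly_Mapping.keys G"
      using pk keys_mult [of F G] by blast
    then have "Poly_Mapping.keys m \<union> Poly_Mapping.keys n \<subseteq> {..N}"
      using assms by (auto simp: forms_def pvars_def)
    then show ?thesis using p d e add keys_add [of m n] by auto
  qed
  then show ?thesis by (auto simp: forms_def pvars_def)
qed

text \<open>
  The union is the zero set of the products of the equations; this is why evaluation has to be
  multiplicative on polynomials.
\<close>

lemma zclosed_Un: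
  assumes "zclosed N A" "zclosed N B"
  shows "zclosed N (A \<union> B)"
proof -
  obtain S T where S: "S \<subseteq> forms N" "A = zero_set N S" and T: "T \<subseteq> forms N" "B = zero_set N T"
    using assms by (auto simp: zclosed_def)
  let ?P = "{F * G | F G. F \<in> S \<and> G \<in> T}"
  have P: "?P \<subseteq> forms N" using S T mult_in_forms by blast
  have key: "line v \<in> zero_set N ?P \<longleftrightarrow> line v \<in> A \<union> B" if "v \<in> vecs N" "v \<noteq> 0" for v
  proof -
    have "(\<forall>H\<in>?P. peval H v = 0) \<longleftrightarrow> (\<forall>F\<in>S. \<forall>G\<in>T. peval F v = 0 \<or> peval G v = 0)"
    proof (intro iffI ballI)
      fix F G assume "\<forall>H\<in>?P. peval H v = 0" "F \<in> S" "G \<in> T"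
      then have "peval (F * G) v = 0" by blast
      then show "peval F v = 0 \<or> peval G v = 0" by (simp add: peval_mult)
    next
      fix H assume "\<forall>F\<in>S. \<forall>G\<in>T. peval F v = 0 \<or> peval G v = 0" "H \<in> ?P"
      then show "peval H v = 0" by (auto simp: peval_mult)
    qed
    also have "\<dots> \<longleftrightarrow> (\<forall>F\<in>S. peval F v = 0) \<or> (\<forall>G\<in>T. peval G v = 0)" by blast
    finally show ?thesis using that S T P by (simp add: line_in_zero_set)
  qed
  have "L \<in> zero_set N ?P \<longleftrightarrow> L \<in> A \<union> B" if LP: "L \<in> pspace N" for L
  proof -
    obtain v where "v \<in> vecs N" "v \<noteq> 0" "L = line v" using LP by (rule pspaceE)
    then show ?thesis using key [of v] by blast
  qed
  moreover have "zero_set N ?P \<subseteq> pspace N" "A \<union> B \<subseteq> pspace N"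
    using S T by (auto simp: zero_set_def)
  ultimately have "zero_set N ?P = A \<union> B" by blast
  then show ?thesis unfolding zclosed_def using P by blast
qed

lemma zclosed_finite:
  assumes "finite A" "A \<noteq> {}" "A \<subseteq> pspace N"
  shows "zclosed N A"
  using assms
proof (induction A rule: finite_ne_induct)
  case (singleton L)
  then show ?case by (simp add: zclosed_point)
next
  case (insert L A)
  then have "zclosed N ({L} \<union> A)" by (intro zclosed_Un zclosed_point) auto
  then show ?case by simp
qed

section \<open>Closed sets whose proper closed subsets are finite\<close>

text \<open>
  The Zariski topology of an irreducible curve is the cofinite one. This property determines
  the possible chains of irreducible closed subsets, hence all dimensions, and it is directly
  accessible for an explicit curve.
\<close>

definition cofinite_curve :: "nat \<Rightarrow> point set \<Rightarrow> bool" where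
  "cofinite_curve N X \<longleftrightarrow> zclosed N X \<and> infinite X \<and> (\<forall>Z. zclosed N Z \<and> Z \<subset> X \<longrightarrow> finite Z)"

text \<open>
  In a finite set, both a point and its complement are closed.
\<close>

lemma irreducible_finite_is_point:
  assumes "irreducible_closed N V" "finite V"
  obtains L where "V = {L}"
proof -
  have V: "zclosed N V" "V \<noteq> {}" "V \<subseteq> pspace N"
    using assms zclosed_subset_pspace by (auto simp: irreducible_closed_def)
  then obtain L where L: "L \<in> V" by blast
  have "V = {L}"
  proof (rule ccontr)
    assume "V \<noteq> {L}"
    then have "zclosed N (V - {L})" using assms(2) V L by (intro zclosed_finite) auto
    moreover have "zclosed N {L}" using L V by (intro zclosed_point) auto
    moreover have "V = {L} \<union> (V - {L})" using L by blast
    ultimately have "V = {L} \<or> V = V - {L}"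
      using assms(1) unfolding irreducible_closed_def by blast
    then show False using \<open>V \<noteq> {L}\<close> L by blast
  qed
  then show thesis by (rule that)
qed

lemma cofinite_curve_irreducible:
  assumes "cofinite_curve N X"
  shows "irreducible_closed N X"
proof -
  have "X = A \<or> X = B" if "zclosed N A" "zclosed N B" "X = A \<union> B" for A B
  proof (rule ccontr)
    assume "\<not> (X = A \<or> X = B)"
    then have "finite A" "finite B" using that assms by (auto simp: cofinite_curve_def)
    then show False using that assms by (auto simp: cofinite_curve_def)
  qed
  then show ?thesis using assms by (auto simp: irreducible_closed_def cofinite_curve_def)
qed

lemma cofinite_curve_proper_is_point:
  assumes "cofinite_curve N X" "irreducible_closed N V" "V \<subset> X"
  obtains L where "V = {L}"
proof -
  have "finite V"
    using assms by (auto simp: cofinite_curve_def irreducible_closed_def)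
  then show thesis using irreducible_finite_is_point [OF assms(2)] that by blast
qed

lemma chain_in_cofinite_curve:
  assumes "cofinite_curve N X" "irreducible_chain N W k X"
  shows "k \<le> 1"
proof (rule ccontr)
  assume "\<not> k \<le> 1"
  then have "0 \<le> k" "1 \<le> k" "2 \<le> k" "0 < k" "1 < k" by auto
  then have "irreducible_closed N (W 0)" "irreducible_closed N (W 1)" "W 2 \<subseteq> X"
    "W 0 \<subset> W (Suc 0)" "W 1 \<subset> W (Suc 1)"
    using assms(2) unfolding irreducible_chain_def by blast+
  then have "irreducible_closed N (W 0)" "irreducible_closed N (W 1)" "W 0 \<subset> W 1" "W 1 \<subset> W 2"
    "W 2 \<subseteq> X" by (simp_all add: numeral_2_eq_2)
  moreover from this have "W 1 \<subset> X" by blast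
  moreover obtain L where "W 1 = {L}"
    by (rule cofinite_curve_proper_is_point [OF assms(1) \<open>irreducible_closed N (W 1)\<close> \<open>W 1 \<subset> X\<close>])
  moreover have "W 0 \<noteq> {}" using \<open>irreducible_closed N (W 0)\<close> by (simp add: irreducible_closed_def)
  ultimately have "W 0 \<subset> {L}" "W 0 \<noteq> {}" by simp_all
  then show False by (simp add: psubset_eq subset_singleton_iff)
qed

lemma zdim_cofinite_curve_le:
  assumes "cofinite_curve N X"
  shows "zdim N X \<le> 1"
  unfolding zdim_def using chain_in_cofinite_curve [OF assms]
  by (intro SUP_least) (auto simp: one_enat_def)

text \<open>
  The chain \<open>{L} \<subset> X\<close> attains the upper bound.
\<close>

lemma local_dim_cofinite_curve:
  assumes "cofinite_curve N X" "L \<in> X"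
  shows "local_dim N X L = 1"
proof (rule antisym)
  show "local_dim N X L \<le> 1"
    unfolding local_dim_def using chain_in_cofinite_curve [OF assms(1)]
    by (intro SUP_least) (auto simp: one_enat_def)
  have L: "L \<in> pspace N" and X: "infinite X"
    using assms zclosed_subset_pspace by (auto simp: cofinite_curve_def)
  have "{L} \<noteq> X" using X by auto
  then have "irreducible_chain N (\<lambda>i. if i = 0 then {L} else X) 1 X"
    using assms L unfolding irreducible_chain_def
    by (auto simp: irreducible_closed_point cofinite_curve_irreducible)
  then have "1 \<in> {k. \<exists>W. irreducible_chain N W k X \<and> L \<in> W 0}"
    by (intro CollectI exI conjI) auto
  then show "1 \<le> local_dim N X L"
    unfolding local_dim_def one_enat_def by (rule SUP_upper)
qed

lemma subvarieties_cofinite_curve: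
  assumes "cofinite_curve N X"
  shows "subvarieties N 1 X \<subseteq> {X}"
proof
  fix V assume V: "V \<in> subvarieties N 1 X"
  have "V = X"
  proof (rule ccontr)
    assume "V \<noteq> X"
    then have "irreducible_closed N V" "V \<subset> X" using V by (auto simp: subvarieties_def)
    then obtain L where L: "V = {L}"
      by (rule cofinite_curve_proper_is_point [OF assms])
    have "k = 0" if chain: "irreducible_chain N W k V" for W k
    proof (rule ccontr)
      assume "k \<noteq> 0"
      then have k: "0 \<le> k" "Suc 0 \<le> k" "0 < k" by auto
      have sub: "W 0 \<noteq> {}" "W i \<subseteq> V" "j < k \<Longrightarrow> W j \<subset> W (Suc j)" if "i \<le> k" for i j
        using chain that by (simp_all add: irreducible_chain_def irreducible_closed_def)
      have "W 0 \<noteq> {}" "W 0 \<subset> W (Suc 0)" "W (Suc 0) \<subseteq> {L}"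
        using sub [OF k(2)] k(3) L by simp_all
      then have "W 0 \<subset> {L}" by (rule_tac psubset_subset_trans)
      then show False using \<open>W 0 \<noteq> {}\<close> by (simp add: psubset_eq subset_singleton_iff)
    qed
    then have "zdim N V \<le> 0"
      unfolding zdim_def by (intro SUP_least) (auto simp: zero_enat_def)
    then show False using V by (auto simp: subvarieties_def zero_enat_def)
  qed
  then show "V \<in> {X}" by simp
qed

section \<open>Reduced cycle groups generated by a single variety\<close>

lemma topspace_quotient_topology: "topspace (quotient_topology T f) = f ` topspace T"
  using quotient_imp_surjective_map [OF quotient_map_quotient_topology] by metis

text \<open>
  The 0-cube is a single point, without boundary, so a spheroid of dimension 0 is determined up to
  homotopy by one value. Spheroids are total functions; their homotopy classes are determined by the
  restrictions to the cube.
\<close>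

lemma homotopy_group_0_subset:
  "homotopy_group 0 T b \<subseteq> (\<lambda>a. homotopy_class 0 T b (\<lambda>t. a)) ` topspace T"
proof
  fix \<alpha> assume "\<alpha> \<in> homotopy_group 0 T b"
  then obtain f where f: "continuous_map (top_of_set (cube 0)) T f" "\<alpha> = homotopy_class 0 T b f"
    by (auto simp: homotopy_group_def spheroid_def)
  let ?P = "\<lambda>h :: (nat \<Rightarrow> real) \<Rightarrow> 'a. \<forall>t\<in>cube_boundary 0. h t = b"
  have c0: "cube 0 = {\<lambda>_. 0}" by (auto simp: cube_def)
  have a: "f (\<lambda>_. 0) \<in> topspace T"
    using f(1) by (auto simp: continuous_map_def c0)
  have "homotopic_with ?P (top_of_set (cube 0)) T f (\<lambda>t. f (\<lambda>_. 0))"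
    using f(1) by (intro homotopic_with_equal) (auto simp: c0 cube_boundary_def)
  then have "homotopy_class 0 T b f = homotopy_class 0 T b (\<lambda>t. f (\<lambda>_. 0))"
    unfolding homotopy_class_def by (blast intro: homotopic_with_trans homotopic_with_symD)
  then show "\<alpha> \<in> (\<lambda>a. homotopy_class 0 T b (\<lambda>t. a)) ` topspace T"
    using a f(2) by blast
qed

lemma set_mult_cycle_group:
  "A <#>\<^bsub>cycle_group N q Y\<^esub> B = {a + b | a b. a \<in> A \<and> b \<in> B}"
  by (auto simp: set_mult_def cycle_group_def free_Abelian_group_def)

lemma carrier_cycle_group: "carrier (cycle_group N q Y) = {c. Poly_Mapping.keys c \<subseteq> subvarieties N q Y}"
  by (simp add: cycle_group_def free_Abelian_group_def)

text \<open>
  For a projective variety the boundary is empty, so cosets modulo boundary cycles are singletons.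
\<close>

lemma boundary_cycles_proj_var: "boundary_cycles (proj_var N X) q = {0}"
proof -
  have "subvarieties N q {} = {}" by (auto simp: subvarieties_def irreducible_closed_def)
  then show ?thesis by (simp add: boundary_cycles_def proj_var_def carrier_cycle_group)
qed

lemma Z_class_proj_var: "Z_class (proj_var N X) q c = {c}"
  by (auto simp: Z_class_def boundary_cycles_proj_var r_coset_def closure_group_def cycle_group_def
      free_Abelian_group_def)

lemma mult_Z_group_proj_var:
  "A \<otimes>\<^bsub>Z_group (proj_var N X) q\<^esub> B = {a + b | a b. a \<in> A \<and> b \<in> B}"
  by (simp add: Z_group_def FactGroup_def closure_group_def set_mult_cycle_group)

lemma singleton_in_Z_group_proj_var:
  assumes "c \<in> carrier (cycle_group N q X)"
  shows "{c} \<in> carrier (Z_group (proj_var N X) q)"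
proof -
  have "{c} = boundary_cycles (proj_var N X) q #>\<^bsub>closure_group (proj_var N X) q\<^esub> c"
    using Z_class_proj_var [of N X q c] by (simp add: Z_class_def)
  then show ?thesis
    using assms unfolding Z_group_def FactGroup_def RCOSETS_def
    by (auto simp: closure_group_def proj_var_def)
qed

text \<open>
  For a conjugation-invariant cycle \<open>d\<close>, the cycle \<open>d + d\<close> is the average of \<open>d\<close>.
\<close>

lemma R_class_add_average:
  assumes "d \<in> carrier (cycle_group N q X)" "conj_cycle d = d"
  shows "R_class (proj_var N X) q {c + d + d} \<subseteq> R_class (proj_var N X) q {c}"
proof
  let ?G = "Z_group (proj_var N X) q"
  fix B assume "B \<in> R_class (proj_var N X) q {c + d + d}"
  then obtain A where A: "A \<in> averaged_cycles (proj_var N X) q" "B = A \<otimes>\<^bsub>?G\<^esub> {c + d + d}"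
    by (auto simp: R_class_def r_coset_def)
  have "{d} \<otimes>\<^bsub>?G\<^esub> conj_cycle ` {d} \<in> averaged_cycles (proj_var N X) q"
    unfolding averaged_cycles_def using singleton_in_Z_group_proj_var [OF assms(1)]
    by (blast intro: generate.incl)
  then have "{d + d} \<in> averaged_cycles (proj_var N X) q"
    by (simp add: mult_Z_group_proj_var assms(2))
  then have "A \<otimes>\<^bsub>?G\<^esub> {d + d} \<in> averaged_cycles (proj_var N X) q"
    using A(1) unfolding averaged_cycles_def by (rule generate.eng [rotated])
  moreover have "B = (A \<otimes>\<^bsub>?G\<^esub> {d + d}) \<otimes>\<^bsub>?G\<^esub> {c}"
  proof -
    have "a + (c + d + d) = (a + (d + d)) + c" for a by (simp add: add_ac)
    then show ?thesis unfolding A(2) mult_Z_group_proj_var by auto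
  qed
  ultimately show "B \<in> R_class (proj_var N X) q {c}"
    unfolding R_class_def r_coset_def by blast
qed

text \<open>
  If \<open>V\<close> is the only subvariety, all cycles are multiples \<open>n V\<close>, and modulo averages only the parity
  of \<open>n\<close> matters.
\<close>

lemma topspace_R_topology_single:
  assumes "subvarieties N q X \<subseteq> {V}" "conj_variety V = V"
  shows "topspace (R_topology (proj_var N X) q) \<subseteq>
    {R_class (proj_var N X) q {0}, R_class (proj_var N X) q {frag_of V}}"
proof
  let ?U = "proj_var N X"
  fix B assume "B \<in> topspace (R_topology ?U q)"
  then obtain A where A: "A \<in> topspace (Z_topology ?U q)" "B = R_class ?U q A"
    by (auto simp: R_topology_def topspace_quotient_topology)
  then obtain c where c: "c \<in> topspace (cycle_topology N q X)" "A = {c}"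
    unfolding Z_topology_def topspace_quotient_topology Z_class_proj_var
    by (auto simp: proj_var_def)
  then obtain a b where "a \<in> effective_cycles N q X" "b \<in> effective_cycles N q X" "c = a - b"
    by (auto simp: cycle_topology_def topspace_quotient_topology chow_monoid_topology_def
        topspace_pullback_topology)
  then have keys: "Poly_Mapping.keys c \<subseteq> subvarieties N q X"
    using keys_diff [of a b] by (auto simp: effective_cycles_def carrier_cycle_group)
  define n where "n = Poly_Mapping.lookup c V"
  have cn: "c = frag_cmul n (frag_of V)"
    using keys assms(1) by (intro poly_mapping_eqI)
      (auto simp: n_def lookup_single when_def in_keys_iff)
  define d where "d k = frag_cmul k (frag_of V)" for k
  have d: "d k \<in> carrier (cycle_group N q X)" "conj_cycle (d k) = d k" if "n \<noteq> 0 \<or> k = 0" for k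
  proof -
    have "Poly_Mapping.keys (d k) \<subseteq> Poly_Mapping.keys c"
      using that by (auto simp: cn d_def)
    then show "d k \<in> carrier (cycle_group N q X)" using keys by (auto simp: carrier_cycle_group)
    show "conj_cycle (d k) = d k"
      by (simp add: conj_cycle_def d_def frag_extend_cmul assms(2))
  qed
  define k where "k = n div 2"
  have k: "n \<noteq> 0 \<or> k = 0" "n \<noteq> 0 \<or> - k = 0" by (auto simp: k_def)
  define r where "r = (if even n then 0 else frag_of V)"
  have cr: "c = r + d k + d k"
  proof -
    have "n = (if even n then 0 else 1) + k + k" unfolding k_def by presburger
    then have "c = frag_cmul ((if even n then 0 else 1) + k + k) (frag_of V)" using cn by simp
    also have "\<dots> = frag_cmul (if even n then 0 else 1) (frag_of V) + d k + d k"
      by (simp only: frag_cmul_distrib d_def)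
    also have "frag_cmul (if even n then 0 else 1) (frag_of V) = r" by (simp add: r_def)
    finally show ?thesis .
  qed
  have rc: "r = c + d (-k) + d (-k)"
  proof -
    have "d (- k) = - d k" by (simp add: d_def)
    then show ?thesis using cr by simp
  qed
  have "R_class ?U q {c} = R_class ?U q {r}"
    using R_class_add_average [OF d [OF k(1)], of r, folded cr]
      R_class_add_average [OF d [OF k(2)], of c, folded rc] by (rule subset_antisym)
  then show "B \<in> {R_class ?U q {0}, R_class ?U q {frag_of V}}"
    using A c by (auto simp: r_def)
qed

text \<open>
  \<open>RL\<^sub>qH\<^sub>q\<close> is the set of path components of a space that has at most two points.
\<close>

lemma RLH_diagonal_single:
  assumes "subvarieties N q X \<subseteq> {V}" "conj_variety V = V"
  shows "finite (RLH q q (proj_var N X)) \<and> card (RLH q q (proj_var N X)) \<le> 2"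
proof -
  let ?T = "R_topology (proj_var N X) q"
  have T: "finite (topspace ?T)" "card (topspace ?T) \<le> 2"
  proof -
    show "finite (topspace ?T)"
      by (rule finite_subset [OF topspace_R_topology_single [OF assms]]) simp
    have "card (topspace ?T) \<le>
        card {R_class (proj_var N X) q {0}, R_class (proj_var N X) q {frag_of V}}"
      by (rule card_mono [OF _ topspace_R_topology_single [OF assms]]) simp
    also have "\<dots> \<le> 2" by (simp add: card_insert_if)
    finally show "card (topspace ?T) \<le> 2" .
  qed
  let ?h = "\<lambda>a. homotopy_class 0 ?T \<one>\<^bsub>R_group (proj_var N X) q\<^esub> (\<lambda>t. a)"
  have "RLH q q (proj_var N X) \<subseteq> ?h ` topspace ?T"
    using homotopy_group_0_subset by (simp add: RLH_def pi_R_def)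
  then have "finite (RLH q q (proj_var N X)) \<and> card (RLH q q (proj_var N X)) \<le> card (?h ` topspace ?T)"
    using card_mono [OF finite_imageI [OF T(1)]] finite_subset [OF _ finite_imageI [OF T(1)]] by blast
  moreover have "card (?h ` topspace ?T) \<le> 2"
    using card_image_le [OF T(1)] T(2) by (rule order_trans)
  ultimately show ?thesis by linarith
qed

section \<open>Winding numbers and mod 2 homology\<close>

definition frag_sum :: "('a \<Rightarrow> complex) \<Rightarrow> ('a \<Rightarrow>\<^sub>0 int) \<Rightarrow> complex" where
  "frag_sum f c = (\<Sum>x\<in>Poly_Mapping.keys c. of_int (Poly_Mapping.lookup c x) * f x)"

lemma frag_sum_superset:
  assumes "finite K" "Poly_Mapping.keys c \<subseteq> K"
  shows "frag_sum f c = (\<Sum>x\<in>K. of_int (Poly_Mapping.lookup c x) * f x)"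
  unfolding frag_sum_def using assms
  by (intro sum.mono_neutral_left) (auto simp: in_keys_iff)

lemma frag_sum_0 [simp]: "frag_sum f 0 = 0"
  by (simp add: frag_sum_def)

lemma frag_sum_of [simp]: "frag_sum f (frag_of x) = f x"
  by (simp add: frag_sum_def)

lemma frag_sum_add: "frag_sum f (a + b) = frag_sum f a + frag_sum f b"
  using keys_add [of a b]
  by (simp add: frag_sum_superset [of "Poly_Mapping.keys a \<union> Poly_Mapping.keys b"]
      lookup_add ring_distribs sum.distrib)

lemma frag_sum_cmul: "frag_sum f (frag_cmul k c) = of_int k * frag_sum f c"
  using keys_cmul [of k c]
  by (simp add: frag_sum_superset [of "Poly_Mapping.keys c"] sum_distrib_left mult_ac)

lemma frag_sum_diff: "frag_sum f (a - b) = frag_sum f a - frag_sum f b"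
  using frag_sum_add [of f "a - b" b] by simp

text \<open>
  The affine parametrization of the standard 1-simplex, from vertex 0 to vertex 1.
\<close>

definition edge_point :: "real \<Rightarrow> nat \<Rightarrow> real" where
  "edge_point t = (\<lambda>i. if i = 0 then 1 - t else if i = 1 then t else 0)"

text \<open>
  The number of turns around the origin, not necessarily integral, of the image under \<open>\<phi>\<close> of a
  singular 1-simplex: its imaginary part measures the change of the modulus.
\<close>

definition turning :: "('a \<Rightarrow> complex) \<Rightarrow> ((nat \<Rightarrow> real) \<Rightarrow> 'a) \<Rightarrow> complex" where
  "turning \<phi> \<sigma> = winding_number (\<lambda>t. \<phi> (\<sigma> (edge_point t))) 0"

lemma edge_point_in_simplex: "edge_point t \<in> standard_simplex 1 \<longleftrightarrow> t \<in> {0..1}"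
  by (auto simp: edge_point_def standard_simplex_def)

lemma continuous_edge_point: "continuous_on S edge_point"
proof (rule continuous_on_coordinatewise_then_product)
  show "continuous_on S (\<lambda>t. edge_point t i)" for i
    unfolding edge_point_def
    by (cases "i = 0"; cases "i = 1") (auto intro!: continuous_intros)
qed

lemma continuous_on_singular_simplex:
  assumes "continuous_map T (top_of_set (- {0})) \<phi>" "singular_simplex p T \<sigma>"
  shows "continuous_on (standard_simplex p) (\<phi> \<circ> \<sigma>)"
    and "x \<in> standard_simplex p \<Longrightarrow> \<phi> (\<sigma> x) \<noteq> 0"
proof -
  have "continuous_map (top_of_set (standard_simplex p)) (top_of_set (- {0})) (\<phi> \<circ> \<sigma>)"
    using assms continuous_map_compose
    by (metis euclidean_product_topology singular_simplex_def)
  then show "continuous_on (standard_simplex p) (\<phi> \<circ> \<sigma>)"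
    "x \<in> standard_simplex p \<Longrightarrow> \<phi> (\<sigma> x) \<noteq> 0"
    by (auto simp: continuous_map_in_subtopology)
qed

lemma path_of_edge:
  assumes "continuous_map T (top_of_set (- {0})) \<phi>" "singular_simplex 1 T \<sigma>"
  shows "path (\<lambda>t. \<phi> (\<sigma> (edge_point t)))" "0 \<notin> path_image (\<lambda>t. \<phi> (\<sigma> (edge_point t)))"
proof -
  have "continuous_on {0..1} ((\<phi> \<circ> \<sigma>) \<circ> edge_point)"
    by (rule continuous_on_compose [OF continuous_edge_point])
      (rule continuous_on_subset [OF continuous_on_singular_simplex(1) [OF assms]],
        auto simp: edge_point_in_simplex simp del: One_nat_def)
  then show "path (\<lambda>t. \<phi> (\<sigma> (edge_point t)))" by (simp add: path_def o_def)
  show "0 \<notin> path_image (\<lambda>t. \<phi> (\<sigma> (edge_point t)))"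
    using continuous_on_singular_simplex(2) [OF assms]
    by (force simp: path_image_def edge_point_in_simplex simp del: One_nat_def)
qed

lemma turning_singular_face:
  "turning \<phi> (singular_face 2 k \<sigma>) = winding_number (\<lambda>t. \<phi> (\<sigma> (simplical_face k (edge_point t)))) 0"
  unfolding turning_def
  by (rule winding_number_cong) (simp add: singular_face_def edge_point_in_simplex [simplified])

text \<open>
  A triangle is simply connected, so two consecutive edges are homotopic to the third one with end
  points fixed. The homotopy is made in the plane triangle \<open>\<Delta>\<close> of barycentric coordinates and
  transported by the singular simplex.
\<close>

lemma turning_triangle:
  assumes \<phi>: "continuous_map T (top_of_set (- {0})) \<phi>" and \<sigma>: "singular_simplex 2 T \<sigma>"
  shows "frag_sum (turning \<phi>) (chain_boundary 2 (frag_of \<sigma>)) = 0"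
proof -
  define P :: "real \<times> real \<Rightarrow> nat \<Rightarrow> real" where
    "P = (\<lambda>(a, b) i. if i = 0 then 1 - a - b else if i = 1 then a else if i = 2 then b else 0)"
  define \<Delta> :: "(real \<times> real) set" where "\<Delta> = {(a, b). 0 \<le> a \<and> 0 \<le> b \<and> a + b \<le> 1}"
  let ?h = "\<lambda>x. \<phi> (\<sigma> (P x))"
  let ?a = "linepath (0, 0) (1, 0 :: real) :: real \<Rightarrow> real \<times> real"
  let ?b = "linepath (1, 0) (0, 1 :: real) :: real \<Rightarrow> real \<times> real"
  let ?c = "linepath (0, 0) (0, 1 :: real) :: real \<Rightarrow> real \<times> real"
  have "P ` \<Delta> \<subseteq> standard_simplex 2"
    by (auto simp: P_def \<Delta>_def standard_simplex_def numeral_2_eq_2)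
  moreover have "continuous_on \<Delta> P"
  proof (rule continuous_on_coordinatewise_then_product)
    show "continuous_on \<Delta> (\<lambda>x. P x i)" for i
      unfolding P_def case_prod_unfold
      by (cases "i = 0"; cases "i = 1"; cases "i = 2") (auto intro!: continuous_intros)
  qed
  ultimately have h: "continuous_on \<Delta> ?h" "?h ` \<Delta> \<subseteq> - {0}"
    using continuous_on_compose [of \<Delta> P "\<phi> \<circ> \<sigma>"] continuous_on_singular_simplex [OF assms]
    by (auto simp: o_def intro: continuous_on_subset)
  have "convex \<Delta>"
  proof (rule convexI)
    fix x y :: "real \<times> real" and u v :: real
    assume *: "x \<in> \<Delta>" "y \<in> \<Delta>" "0 \<le> u" "0 \<le> v" "u + v = 1"
    have "u * (fst x + snd x) + v * (fst y + snd y) \<le> u * 1 + v * 1"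
      using * by (intro add_mono mult_left_mono) (auto simp: \<Delta>_def)
    then show "u *\<^sub>R x + v *\<^sub>R y \<in> \<Delta>"
      using * by (auto simp: \<Delta>_def case_prod_unfold algebra_simps)
  qed
  then have "simply_connected \<Delta>" by (rule convex_imp_simply_connected)
  moreover have seg: "path_image ?a \<subseteq> \<Delta>" "path_image ?b \<subseteq> \<Delta>" "path_image ?c \<subseteq> \<Delta>"
    unfolding path_image_linepath
    by (rule closed_segment_subset, simp_all add: \<Delta>_def \<open>convex \<Delta>\<close> [unfolded \<Delta>_def])+
  ultimately have "homotopic_paths \<Delta> (?a +++ ?b) ?c"
    unfolding simply_connected_eq_homotopic_paths
    by (simp add: path_image_join)
  then have "homotopic_paths (- {0}) (?h \<circ> (?a +++ ?b)) (?h \<circ> ?c)"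
    using h by (intro homotopic_paths_continuous_image) auto
  then have "winding_number ((?h \<circ> ?a) +++ (?h \<circ> ?b)) 0 = winding_number (?h \<circ> ?c) 0"
    by (simp add: winding_number_homotopic_paths path_compose_join)
  moreover have "path (?h \<circ> ?a)" "path (?h \<circ> ?b)" "0 \<notin> path_image (?h \<circ> ?a)" "0 \<notin> path_image (?h \<circ> ?b)"
    using h seg by (auto intro!: path_continuous_image continuous_on_subset [OF h(1)]
        simp: path_image_compose)
  ultimately have "winding_number (?h \<circ> ?a) 0 + winding_number (?h \<circ> ?b) 0 = winding_number (?h \<circ> ?c) 0"
    by (subst (asm) winding_number_join) (auto simp: pathfinish_compose pathstart_compose)
  moreover have "P (?a t) = simplical_face 2 (edge_point t)" "P (?b t) = simplical_face 0 (edge_point t)"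
    "P (?c t) = simplical_face 1 (edge_point t)" for t
    by (auto simp: P_def linepath_def simplical_face_def edge_point_def fun_eq_iff)
  ultimately have "turning \<phi> (singular_face 2 2 \<sigma>) + turning \<phi> (singular_face 2 0 \<sigma>) =
      turning \<phi> (singular_face 2 1 \<sigma>)"
    by (simp only: turning_singular_face o_def)
  then show ?thesis
    by (simp add: chain_boundary_of frag_sum_add frag_sum_diff numeral_2_eq_2 algebra_simps)
qed

lemma turning_boundary:
  assumes \<phi>: "continuous_map T (top_of_set (- {0})) \<phi>" and d: "singular_chain 2 T d"
  shows "frag_sum (turning \<phi>) (chain_boundary 2 d) = 0"
  using d unfolding singular_chain_def
proof (induction d rule: frag_induction)
  case (one \<sigma>)
  then show ?case using turning_triangle [OF \<phi>] by simp
qed (simp_all add: chain_boundary_diff frag_sum_diff)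

text \<open>
  Modulo integers, the winding number of a path is the difference of the values at its end points
  of \<open>lg\<close>, the logarithm divided by \<open>2 \<pi> i\<close>, because the exponential of \<open>2 \<pi> i\<close> times it is the quotient of the end points. Hence
  modulo integers the winding number of a chain depends on its boundary only.
\<close>

lemma turning_cycle_in_Ints:
  assumes \<phi>: "continuous_map T (top_of_set (- {0})) \<phi>"
    and c: "singular_chain 1 T c" "chain_boundary 1 c = 0"
  shows "frag_sum (turning \<phi>) c \<in> \<int>"
proof -
  define lg where "lg \<tau> = Ln (\<phi> (\<tau> (\<lambda>i. if i = 0 then 1 else 0))) / (2 * of_real pi * \<i>)"
    for \<tau> :: "(nat \<Rightarrow> real) \<Rightarrow> 'a"
  have "frag_sum (turning \<phi>) c - frag_sum lg (chain_boundary 1 c) \<in> \<int>"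
    using c(1) unfolding singular_chain_def
  proof (induction c rule: frag_induction)
    case zero
    then show ?case by simp
  next
    case (one \<sigma>)
    then have \<sigma>: "singular_simplex 1 T \<sigma>" by simp
    let ?p = "\<lambda>t. \<phi> (\<sigma> (edge_point t))"
    have v: "simplical_face 0 (\<lambda>i. if i = 0 then 1 else 0) = edge_point 1"
      "simplical_face 1 (\<lambda>i. if i = 0 then 1 else 0) = edge_point 0"
      by (auto simp: simplical_face_def edge_point_def fun_eq_iff)
    have "(\<lambda>i. if i = 0 then 1 else 0) \<in> standard_simplex 0" by (simp add: standard_simplex_0)
    then have l: "lg (singular_face 1 0 \<sigma>) = Ln (?p 1) / (2 * of_real pi * \<i>)"
      "lg (singular_face 1 1 \<sigma>) = Ln (?p 0) / (2 * of_real pi * \<i>)"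
      using v by (simp_all add: lg_def singular_face_def)
    have nz: "?p 0 \<noteq> 0" "?p 1 \<noteq> 0"
      using path_of_edge(2) [OF \<phi> \<sigma>] by (auto simp: path_image_def image_iff)
    have "?p 1 = exp (2 * of_real pi * \<i> * winding_number ?p 0) * ?p 0"
      using winding_number_exp_2pi [OF path_of_edge [OF \<phi> \<sigma>]]
      by (simp add: pathstart_def pathfinish_def mult_ac)
    then have "exp (2 * of_real pi * \<i> * winding_number ?p 0 - Ln (?p 1) + Ln (?p 0)) = 1"
      using nz by (simp add: exp_diff exp_add del: exp_of_real)
    then obtain n :: int
      where "2 * of_real pi * \<i> * winding_number ?p 0 - Ln (?p 1) + Ln (?p 0) = of_int n * (2 * of_real pi * \<i>)"
      unfolding exp_eq_1 by (auto simp: complex_eq_iff)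
    then have "winding_number ?p 0 - (Ln (?p 1) - Ln (?p 0)) / (2 * of_real pi * \<i>) = of_int n"
      by (simp add: field_simps)
    then have "winding_number ?p 0 - (Ln (?p 1) - Ln (?p 0)) / (2 * of_real pi * \<i>) \<in> \<int>"
      by simp
    then show ?case
      using l by (simp add: chain_boundary_of frag_sum_diff turning_def diff_divide_distrib)
  next
    case (diff a b)
    then have "(frag_sum (turning \<phi>) a - frag_sum lg (chain_boundary 1 a)) -
        (frag_sum (turning \<phi>) b - frag_sum lg (chain_boundary 1 b)) \<in> \<int>" by (rule Ints_diff)
    then show ?case by (simp add: chain_boundary_diff frag_sum_diff algebra_simps)
  qed
  then show ?thesis using c(2) by simp
qed

text \<open>
  If a cycle is \<open>\<partial>d + 2 e\<close>, then \<open>2 \<partial>e = 0\<close>, so \<open>e\<close> is an integral cycle as chain groups are free of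
  torsion. Its winding number is an integer, and \<open>\<partial>d\<close> contributes nothing.
\<close>

lemma turning_mod2_boundary:
  assumes \<phi>: "continuous_map T (top_of_set (- {0})) \<phi>"
    and c: "chain_boundary 1 c = 0" "c \<in> mod2_boundaries 1 T"
  obtains k where "frag_sum (turning \<phi>) c = 2 * of_int k"
proof -
  obtain d e where d: "singular_chain 2 T d" and e: "singular_chain 1 T e"
    and eq: "c = chain_boundary 2 d + frag_cmul 2 e"
    using c(2) by (auto simp: mod2_boundaries_def numeral_2_eq_2)
  have "chain_boundary 1 (chain_boundary 2 d) = 0"
    using chain_boundary_boundary [OF d] by simp
  then have "frag_cmul 2 (chain_boundary 1 e) = 0"
    using c(1) unfolding eq by (simp add: chain_boundary_add chain_boundary_cmul)
  then have "chain_boundary 1 e = 0" by simp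
  then obtain k where "frag_sum (turning \<phi>) e = of_int k"
    using turning_cycle_in_Ints [OF \<phi> e] by (auto simp: Ints_def)
  then have "frag_sum (turning \<phi>) c = 2 * of_int k"
    by (simp add: eq frag_sum_add frag_sum_cmul turning_boundary [OF \<phi> d])
  then show thesis by (rule that)
qed

text \<open>
  The path \<open>g\<close> as a singular 1-simplex, the parameter being the barycentric coordinate of vertex 1.
\<close>

definition loop_simplex :: "(real \<Rightarrow> 'a) \<Rightarrow> (nat \<Rightarrow> real) \<Rightarrow> 'a" where
  "loop_simplex g = restrict (\<lambda>x. g (x 1)) (standard_simplex 1)"

lemma singular_simplex_loop:
  assumes "continuous_map (top_of_set {0..1}) T g"
  shows "singular_simplex 1 T (loop_simplex g)"
proof -
  have "continuous_map (top_of_set (standard_simplex 1)) (top_of_set {0..1}) (\<lambda>x. x 1)"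
    by (auto simp: standard_simplex_def
        intro!: continuous_on_subset [OF continuous_on_product_coordinates])
  from continuous_map_compose [OF this assms]
  have "continuous_map (top_of_set (standard_simplex 1)) T (loop_simplex g)"
    by (rule continuous_map_eq) (simp add: loop_simplex_def)
  then show ?thesis
    by (simp add: singular_simplex_def loop_simplex_def euclidean_product_topology)
qed

lemma chain_boundary_loop:
  assumes "g 0 = g 1"
  shows "chain_boundary 1 (frag_of (loop_simplex g)) = 0"
proof -
  have "singular_face 1 0 (loop_simplex g) = singular_face 1 1 (loop_simplex g)"
    using assms
    by (auto simp: singular_face_def loop_simplex_def standard_simplex_0 simplical_face_def
        restrict_def fun_eq_iff standard_simplex_def)
  then show ?thesis by (simp add: chain_boundary_of)
qed

lemma turning_loop: "turning \<phi> (loop_simplex g) = winding_number (\<phi> \<circ> g) 0"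
  unfolding turning_def
proof (rule winding_number_cong)
  fix t :: real assume "0 \<le> t" "t \<le> 1"
  then have "edge_point t \<in> standard_simplex 1" by (simp only: edge_point_in_simplex atLeastAtMost_iff)
  moreover have "edge_point t 1 = t" by (simp add: edge_point_def)
  ultimately show "\<phi> (loop_simplex g (edge_point t)) = (\<phi> \<circ> g) t"
    by (simp only: loop_simplex_def restrict_apply' o_def)
qed

section \<open>The top step of the niveau filtration\<close>

lemma zero_in_mod2_boundaries: "0 \<in> mod2_boundaries n T"
  unfolding mod2_boundaries_def by (rule CollectI, rule exI [of _ 0], rule exI [of _ 0]) simp

lemma mod2_boundaries_add:
  assumes "a \<in> mod2_boundaries n T" "b \<in> mod2_boundaries n T"
  shows "a + b \<in> mod2_boundaries n T"
proof -
  obtain d e d' e' where "singular_chain (Suc n) T d" "singular_chain n T e"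
    "singular_chain (Suc n) T d'" "singular_chain n T e'"
    and ab: "a = chain_boundary (Suc n) d + frag_cmul 2 e" "b = chain_boundary (Suc n) d' + frag_cmul 2 e'"
    using assms by (auto simp: mod2_boundaries_def)
  moreover have "a + b = chain_boundary (Suc n) (d + d') + frag_cmul 2 (e + e')"
    by (simp add: ab chain_boundary_add frag_cmul_distrib2)
  ultimately show ?thesis
    unfolding mod2_boundaries_def using singular_chain_add by blast
qed

lemma mod2_boundaries_chain: "a \<in> mod2_boundaries n T \<Longrightarrow> singular_chain n T a"
  by (auto simp: mod2_boundaries_def intro!: singular_chain_add singular_chain_boundary_alt
      singular_chain_cmul)

text \<open>
  When \<open>p\<close> is at least the dimension of \<open>X\<close>, the subvariety \<open>V = X\<close> contributes all mod 2 classes.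
  Here \<open>\<Phi> c\<close> is the image of the class of \<open>c\<close> under the map induced by the identity. This avoids
  showing that the induced map is the identity on all of the homology.
\<close>

lemma niveau_of_whole_variety:
  assumes "real_zclosed N X" "zdim N X \<le> enat p"
  obtains \<Phi> where "\<And>c. c \<in> mod2_cycles n (real_locus N X) \<Longrightarrow> \<Phi> c \<in> niveau p n N X"
    and "\<And>c c'. \<lbrakk>c \<in> mod2_cycles n (real_locus N X); c' \<in> mod2_cycles n (real_locus N X); \<Phi> c = \<Phi> c'\<rbrakk>
      \<Longrightarrow> c - c' \<in> mod2_boundaries n (real_locus N X)"
proof -
  let ?T = "real_locus N X"
  let ?B = "mod2_boundaries n ?T"
  define h where "h c = {b + c | b. b \<in> ?B}" for c
  define \<Phi> where "\<Phi> c = mod2_hom_induced n ?T ?T id (h c)" for c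
  have mem: "\<Phi> c = {b + c | b. b \<in> ?B}" if "c \<in> mod2_cycles n ?T" for c
  proof -
    have c: "singular_chain n ?T c" using that by (simp add: mod2_cycles_def)
    have id: "chain_map n id (b + c) = b + c" if "b \<in> ?B" for b
      using that c by (intro chain_map_ident) (auto intro: singular_chain_add mod2_boundaries_chain)
    have "\<Phi> c = {b + chain_map n id (b' + c) | b b'. b \<in> ?B \<and> b' \<in> ?B}"
      unfolding \<Phi>_def h_def mod2_hom_induced_def set_mult_def chain_group_def free_Abelian_group_def
      by auto
    also have "\<dots> = {b + (b' + c) | b b'. b \<in> ?B \<and> b' \<in> ?B}"
      using id by (intro Collect_cong) metis
    also have "\<dots> = {b + c | b. b \<in> ?B}"
      using zero_in_mod2_boundaries [of n ?T] mod2_boundaries_add [of _ n ?T]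
      by (metis (no_types, opaque_lifting) add.assoc add_0)
    finally show ?thesis .
  qed
  have h: "h c \<in> carrier (real_homology n N X)" if "c \<in> mod2_cycles n ?T" for c
  proof -
    let ?G = "subgroup_generated (chain_group n ?T) (mod2_cycles n ?T)"
    have "c \<in> carrier (chain_group n ?T)"
      using that by (auto simp: mod2_cycles_def carrier_chain_group)
    then have "c \<in> carrier ?G"
      unfolding carrier_subgroup_generated using that by (intro generate.incl) auto
    moreover have "h c = ?B #>\<^bsub>?G\<^esub> c"
      by (auto simp: h_def r_coset_def chain_group_def free_Abelian_group_def)
    ultimately show ?thesis
      unfolding real_homology_def mod2_homology_group_def FactGroup_def RCOSETS_def by auto
  qed
  show thesis
  proof (rule that)
    fix c assume "c \<in> mod2_cycles n ?T"
    then show "\<Phi> c \<in> niveau p n N X"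
      unfolding niveau_def \<Phi>_def using assms h by (intro generate.incl) blast
  next
    fix c c' assume c: "c \<in> mod2_cycles n ?T" "c' \<in> mod2_cycles n ?T" "\<Phi> c = \<Phi> c'"
    have "c \<in> \<Phi> c"
      unfolding mem [OF c(1)] using zero_in_mod2_boundaries by force
    then show "c - c' \<in> ?B"
      using c(3) unfolding mem [OF c(2)] by auto
  qed
qed

section \<open>Functions on a double cover of the affine line\<close>

text \<open>
  The functions on the curve \<open>y\<^sup>2 = h(s)\<close> that are regular: as a module over the polynomials in \<open>s\<close>
  they have the basis \<open>1, y\<close>.
\<close>

definition cover_fun :: "complex poly \<Rightarrow> (complex \<Rightarrow> complex \<Rightarrow> complex) \<Rightarrow> bool" where
  "cover_fun h f \<longleftrightarrow> (\<exists>A B. \<forall>s y. y\<^sup>2 = poly h s \<longrightarrow> f s y = poly A s + y * poly B s)"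

lemma cover_fun_poly: "cover_fun h (\<lambda>s y. poly A s)"
  unfolding cover_fun_def by (rule exI [of _ A], rule exI [of _ 0]) simp

lemma cover_fun_const: "cover_fun h (\<lambda>s y. a)"
  using cover_fun_poly [of h "[:a:]"] by simp

lemma cover_fun_root: "cover_fun h (\<lambda>s y. y)"
  unfolding cover_fun_def by (rule exI [of _ 0], rule exI [of _ 1]) simp

lemma cover_fun_add:
  assumes "cover_fun h f" "cover_fun h g"
  shows "cover_fun h (\<lambda>s y. f s y + g s y)"
proof -
  obtain A B A' B' where "\<And>s y. y\<^sup>2 = poly h s \<Longrightarrow> f s y = poly A s + y * poly B s"
    "\<And>s y. y\<^sup>2 = poly h s \<Longrightarrow> g s y = poly A' s + y * poly B' s"
    using assms unfolding cover_fun_def by blast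
  then show ?thesis
    unfolding cover_fun_def
    by (intro exI [of _ "A + A'"] exI [of _ "B + B'"]) (simp add: algebra_simps)
qed

lemma cover_fun_mult:
  assumes "cover_fun h f" "cover_fun h g"
  shows "cover_fun h (\<lambda>s y. f s y * g s y)"
proof -
  obtain A B A' B' where *: "\<And>s y. y\<^sup>2 = poly h s \<Longrightarrow> f s y = poly A s + y * poly B s"
    "\<And>s y. y\<^sup>2 = poly h s \<Longrightarrow> g s y = poly A' s + y * poly B' s"
    using assms unfolding cover_fun_def by blast
  have "f s y * g s y = poly (A * A' + h * B * B') s + y * poly (A * B' + A' * B) s"
    if "y\<^sup>2 = poly h s" for s y
    using that by (simp add: * flip: that) (simp add: algebra_simps power2_eq_square)
  then show ?thesis unfolding cover_fun_def by blast
qed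

lemma cover_fun_power: "cover_fun h f \<Longrightarrow> cover_fun h (\<lambda>s y. f s y ^ n)"
  by (induction n) (auto simp: cover_fun_const intro: cover_fun_mult)

lemma cover_fun_sum:
  "(\<And>i. i \<in> I \<Longrightarrow> cover_fun h (f i)) \<Longrightarrow> cover_fun h (\<lambda>s y. \<Sum>i\<in>I. f i s y)"
  by (induction I rule: infinite_finite_induct) (auto simp: cover_fun_const intro: cover_fun_add)

lemma cover_fun_prod:
  "(\<And>i. i \<in> I \<Longrightarrow> cover_fun h (f i)) \<Longrightarrow> cover_fun h (\<lambda>s y. \<Prod>i\<in>I. f i s y)"
  by (induction I rule: infinite_finite_induct) (auto simp: cover_fun_const intro: cover_fun_mult)

lemma cover_fun_peval:
  assumes "\<And>i. cover_fun h (f i)"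
  shows "cover_fun h (\<lambda>s y. peval F (\<lambda>i. f i s y))"
  unfolding peval_def
  by (intro cover_fun_sum cover_fun_mult cover_fun_const cover_fun_prod cover_fun_power assms)

text \<open>
  A zero of \<open>A + y B\<close> satisfies \<open>A\<^sup>2 = h B\<^sup>2\<close>, which has finitely many solutions \<open>s\<close> unless it is an
  identity of polynomials. In that case \<open>A = B = 0\<close>, since the order at a simple root of \<open>h\<close> is even
  on the left and odd on the right.
\<close>

lemma cover_fun_zeros:
  assumes f: "cover_fun h f" and r: "poly h r = 0" "poly (pderiv h) r \<noteq> 0"
  shows "finite {(s, y). y\<^sup>2 = poly h s \<and> f s y = 0} \<or> (\<forall>s y. y\<^sup>2 = poly h s \<longrightarrow> f s y = 0)"
proof -
  obtain A B where AB: "\<And>s y. y\<^sup>2 = poly h s \<Longrightarrow> f s y = poly A s + y * poly B s"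
    using f unfolding cover_fun_def by blast
  define D where "D = A * A - h * (B * B)"
  show ?thesis
  proof (cases "D = 0")
    case False
    have "poly D s = 0" if "y\<^sup>2 = poly h s" "f s y = 0" for s y
    proof -
      have "poly A s = - y * poly B s" using that AB [OF that(1)] by (simp add: add_eq_0_iff)
      then show ?thesis using that(1) by (simp add: D_def power2_eq_square flip: that(1))
    qed
    moreover have "{y. y\<^sup>2 = poly h s} \<subseteq> {csqrt (poly h s), - csqrt (poly h s)}" for s
      using power2_eq_iff [of _ "csqrt (poly h s)"] by auto
    ultimately have "{(s, y). y\<^sup>2 = poly h s \<and> f s y = 0} \<subseteq>
        (SIGMA s:{s. poly D s = 0}. {csqrt (poly h s), - csqrt (poly h s)})"
      by blast
    moreover have "finite (SIGMA s:{s. poly D s = 0}. {csqrt (poly h s), - csqrt (poly h s)})"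
      using poly_roots_finite [OF False] by (intro finite_SigmaI) auto
    ultimately show ?thesis using finite_subset by blast
  next
    case True
    obtain g where g: "h = [:- r, 1:] * g" using r(1) by (auto simp: poly_eq_0_iff_dvd elim: dvdE)
    have "pderiv h = [:- r, 1:] * pderiv g + g * pderiv [:- r, 1:]" by (simp only: g pderiv_mult)
    then have "poly (pderiv h) r = poly g r" by (simp add: pderiv_pCons)
    then have "poly g r \<noteq> 0" using r(2) by simp
    then have "Polynomial.order r g = 0" by (rule order_0I)
    moreover have h0: "h \<noteq> 0" using r(2) by auto
    moreover have "Polynomial.order r h = Polynomial.order r [:- r, 1:] + Polynomial.order r g"
      using h0 unfolding g by (rule order_mult)
    ultimately have h1: "Polynomial.order r h = 1"
      using order_power_n_n [of r 1] by simp
    have "B = 0"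
    proof (rule ccontr)
      assume "B \<noteq> 0"
      then have "h * (B * B) \<noteq> 0" using h0 by simp
      moreover from this have "A * A \<noteq> 0" using True by (simp add: D_def)
      moreover have "A * A = h * (B * B)" using True by (simp add: D_def)
      ultimately have "Polynomial.order r A + Polynomial.order r A = 1 + (Polynomial.order r B + Polynomial.order r B)"
        using h1 \<open>B \<noteq> 0\<close> by (metis no_zero_divisors order_mult)
      then show False by presburger
    qed
    moreover from this have "A = 0" using True by (simp add: D_def)
    ultimately show ?thesis using AB by simp
  qed
qed

section \<open>An elliptic curve with two real components\<close>

definition vec4 :: "complex \<Rightarrow> complex \<Rightarrow> complex \<Rightarrow> complex \<Rightarrow> nat \<Rightarrow> complex" where
  "vec4 a b c d i = (if i = 0 then a else if i = 1 then b else if i = 2 then c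
     else if i = 3 then d else 0)"

lemma vec4_simps [simp]: "vec4 a b c d 0 = a" "vec4 a b c d (Suc 0) = b" "vec4 a b c d 2 = c"
  "vec4 a b c d 3 = d"
  by (simp_all add: vec4_def)

lemma vec4_in_vecs [simp]: "vec4 a b c d \<in> vecs 3"
  by (simp add: vec4_def vecs_def)

lemma nat_cases_4: "(i::nat) = 0 \<or> i = 1 \<or> i = 2 \<or> i = 3 \<or> i > 3"
  by linarith

lemma vecs_3_eqI:
  assumes "v \<in> vecs 3" "w \<in> vecs 3" "v 0 = w 0" "v 1 = w 1" "v 2 = w 2" "v 3 = w 3"
  shows "v = w"
proof
  fix i show "v i = w i" using assms nat_cases_4 [of i] by (auto simp: vecs_def)
qed

definition circle_form :: "nat cpoly" where
  "circle_form = (\<Sum>i\<in>{0, 1, 2}. power_term (if i = 0 then - 1 else 1) 2 i)"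

definition sheet_form :: "nat cpoly" where
  "sheet_form = (\<Sum>i\<in>{0, 1, 3}. power_term (if i = 3 then - 1 else 1) 2 i)"

text \<open>
  A smooth intersection of two quadrics in \<open>\<P>\<^sup>3\<close>, hence a curve of genus 1. The form
  \<open>x\<^sub>0\<^sup>2 + x\<^sub>1\<^sup>2\<close> is positive on the real conic, so the real double cover of the circle splits.
\<close>

definition two_oval_curve :: "point set" where
  "two_oval_curve = zero_set 3 {circle_form, sheet_form}"

definition on_cone :: "(nat \<Rightarrow> complex) \<Rightarrow> bool" where
  "on_cone v \<longleftrightarrow> (v 0)\<^sup>2 = (v 1)\<^sup>2 + (v 2)\<^sup>2 \<and> (v 3)\<^sup>2 = (v 0)\<^sup>2 + (v 1)\<^sup>2"

lemma peval_circle_form: "peval circle_form v = (v 1)\<^sup>2 + (v 2)\<^sup>2 - (v 0)\<^sup>2"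
  unfolding circle_form_def by (subst peval_sum_power_terms) simp_all

lemma peval_sheet_form: "peval sheet_form v = (v 0)\<^sup>2 + (v 1)\<^sup>2 - (v 3)\<^sup>2"
  unfolding sheet_form_def by (subst peval_sum_power_terms) simp_all

lemma curve_forms: "{circle_form, sheet_form} \<subseteq> forms 3"
  unfolding circle_form_def sheet_form_def insert_subset
  by (intro conjI sum_power_terms_in_forms empty_subsetI) auto

lemma line_in_curve:
  assumes "v \<in> vecs 3" "v \<noteq> 0"
  shows "line v \<in> two_oval_curve \<longleftrightarrow> on_cone v"
  unfolding two_oval_curve_def line_in_zero_set [OF curve_forms assms]
  by (auto simp: peval_circle_form peval_sheet_form on_cone_def)

lemma curve_pointD:
  assumes "L \<in> two_oval_curve" "v \<in> L"
  shows "v \<in> vecs 3" "v \<noteq> 0" "L = line v" "on_cone v"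
proof -
  have "L \<in> pspace 3" using assms(1) by (simp add: two_oval_curve_def zero_set_def)
  then show "v \<in> vecs 3" "v \<noteq> 0" "L = line v" using pspace_memD assms(2) by blast+
  then show "on_cone v" using line_in_curve assms(1) by blast
qed

lemma curve_pointE:
  assumes "L \<in> two_oval_curve"
  obtains v where "v \<in> vecs 3" "v \<noteq> 0" "L = line v" "on_cone v"
proof -
  have "L \<in> pspace 3" using assms(1) by (simp add: two_oval_curve_def zero_set_def)
  then obtain v where "v \<in> vecs 3" "v \<noteq> 0" "L = line v" by (rule pspaceE)
  then show thesis using that assms line_in_curve by blast
qed

lemma real_zclosed_curve: "real_zclosed 3 two_oval_curve"
proof -
  have "Poly_Mapping.lookup circle_form m \<in> \<real>" "Poly_Mapping.lookup sheet_form m \<in> \<real>" for m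
    unfolding circle_form_def sheet_form_def by (rule real_sum_power_terms; simp)+
  then have "\<forall>F\<in>{circle_form, sheet_form}. \<forall>m. Poly_Mapping.lookup F m \<in> \<real>" by blast
  then show ?thesis unfolding real_zclosed_def two_oval_curve_def using curve_forms by blast
qed

lemma zclosed_curve: "zclosed 3 two_oval_curve"
  using real_zclosed_curve by (auto simp: zclosed_def real_zclosed_def)

text \<open>
  The equations have real coefficients.
\<close>

lemma conj_two_oval_curve: "conj_variety two_oval_curve = two_oval_curve"
proof -
  let ?c = "\<lambda>v i. cnj (v i) :: complex"
  have im: "?c ` line v = line (?c v)" for v :: "nat \<Rightarrow> complex"
  proof
    show "?c ` line v \<subseteq> line (?c v)"
    proof
      fix w assume "w \<in> ?c ` line v"
      then obtain a where "a \<noteq> 0" "w = ?c (\<lambda>i. a * v i)" unfolding line_def by blast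
      then have "w = (\<lambda>i. cnj a * cnj (v i))" "cnj a \<noteq> 0" by simp_all
      then show "w \<in> line (?c v)" unfolding line_def by blast
    qed
    show "line (?c v) \<subseteq> ?c ` line v"
    proof
      fix w assume "w \<in> line (?c v)"
      then obtain a where "a \<noteq> 0" "w = (\<lambda>i. a * cnj (v i))" by (auto simp: line_def)
      then have "w = ?c (\<lambda>i. cnj a * v i)" "cnj a \<noteq> 0" by simp_all
      then show "w \<in> ?c ` line v"
        unfolding line_def by (intro image_eqI [where x = "\<lambda>i. cnj a * v i"]) blast+
    qed
  qed
  have mem: "?c ` L \<in> two_oval_curve" if L: "L \<in> two_oval_curve" for L
  proof -
    obtain v where v: "v \<in> vecs 3" "v \<noteq> 0" "L = line v" "on_cone v"
      using L by (rule curve_pointE)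
    have "?c v \<in> vecs 3" "?c v \<noteq> 0" using v(1,2) by (auto simp: vecs_def fun_eq_iff)
    moreover have "on_cone (?c v)"
    proof -
      have "cnj ((v 0)\<^sup>2) = cnj ((v 1)\<^sup>2 + (v 2)\<^sup>2)" "cnj ((v 3)\<^sup>2) = cnj ((v 0)\<^sup>2 + (v 1)\<^sup>2)"
        using v(4) by (simp_all only: on_cone_def)
      then show ?thesis by (simp only: on_cone_def complex_cnj_add complex_cnj_power)
    qed
    ultimately show ?thesis unfolding v(3) im using line_in_curve by blast
  qed
  show ?thesis unfolding conj_variety_def
  proof
    show "(\<lambda>L. ?c ` L) ` two_oval_curve \<subseteq> two_oval_curve" using mem by blast
    show "two_oval_curve \<subseteq> (\<lambda>L. ?c ` L) ` two_oval_curve"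
    proof
      fix L assume "L \<in> two_oval_curve"
      then have "?c ` L \<in> two_oval_curve" by (rule mem)
      moreover have "L = ?c ` ?c ` L" by (simp add: image_image)
      ultimately show "L \<in> (\<lambda>L. ?c ` L) ` two_oval_curve" by (rule rev_image_eqI)
    qed
  qed
qed

section \<open>Irreducibility of the curve\<close>

text \<open>
  In the rational parametrization of the conic used in \<open>chart\<close>, this is the quadratic form
  \<open>x\<^sub>0\<^sup>2 + x\<^sub>1\<^sup>2\<close>: a quartic with four simple roots.
\<close>

definition branch_poly :: "complex poly" where
  "branch_poly = [:1, 0, 6, 0, 1:]"

lemma poly_branch_poly: "poly branch_poly s = (s\<^sup>2 + 1)\<^sup>2 + (2 * s)\<^sup>2"
  by (simp add: branch_poly_def power2_eq_square algebra_simps)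

lemma branch_poly_simple_root:
  obtains r where "poly branch_poly r = 0" "poly (pderiv branch_poly) r \<noteq> 0"
proof -
  \<comment> \<open>The polynomial is \<open>s\<^sup>4 + 6 s\<^sup>2 + 1\<close>, a quadratic in \<open>s\<^sup>2\<close>.\<close>
  define r where "r = csqrt (- 3 + of_real (sqrt 8))"
  have r2: "r\<^sup>2 = - 3 + of_real (sqrt 8)" by (simp add: r_def)
  have s8: "(of_real (sqrt 8) :: complex)\<^sup>2 = 8" by (simp flip: of_real_power)
  have "poly branch_poly r = (r\<^sup>2)\<^sup>2 + 6 * r\<^sup>2 + 1"
    by (simp add: branch_poly_def power2_eq_square algebra_simps)
  also have "\<dots> = 0" unfolding r2 using s8 by (simp add: power2_eq_square algebra_simps)
  finally have "poly branch_poly r = 0" .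
  moreover have "poly (pderiv branch_poly) r = 4 * r * (r\<^sup>2 + 3)"
    by (simp add: branch_poly_def pderiv_pCons power2_eq_square algebra_simps)
  moreover have "r \<noteq> 0" using calculation(1) by (auto simp: branch_poly_def)
  ultimately show thesis using that r2 by simp
qed

text \<open>
  Stereographic projection parametrizes the conic \<open>x\<^sub>1\<^sup>2 + x\<^sub>2\<^sup>2 = x\<^sub>0\<^sup>2\<close> by
  \<open>(s\<^sup>2 + 1 : 2 s : s\<^sup>2 - 1)\<close>, except for one point. The charts for \<open>\<epsilon> = 1\<close> and \<open>\<epsilon> = -1\<close>, which project
  from the two points with \<open>x\<^sub>1 = 0\<close>, together cover it; they are related by \<open>s \<mapsto> 1/s\<close>.
\<close>

definition chart :: "complex \<Rightarrow> complex \<Rightarrow> complex \<Rightarrow> nat \<Rightarrow> complex" where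
  "chart \<epsilon> s y = vec4 (s\<^sup>2 + 1) (2 * s) (\<epsilon> * (s\<^sup>2 - 1)) y"

lemma chart_nonzero: "chart \<epsilon> s y \<noteq> 0"
proof
  assume "chart \<epsilon> s y = 0"
  then have "chart \<epsilon> s y 0 = 0" "chart \<epsilon> s y 1 = 0" by simp_all
  then show False by (simp add: chart_def)
qed

lemma chart_in_vecs: "chart \<epsilon> s y \<in> vecs 3"
  by (simp add: chart_def)

lemma chart_on_cone:
  assumes "\<epsilon>\<^sup>2 = 1" "y\<^sup>2 = poly branch_poly s"
  shows "on_cone (chart \<epsilon> s y)"
  using assms by (simp add: on_cone_def chart_def poly_branch_poly power_mult_distrib)
    (simp add: power2_eq_square algebra_simps)

lemma chart_covers:
  assumes v: "v \<in> vecs 3" "v \<noteq> 0" "on_cone v"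
  obtains \<epsilon> c s y where "\<epsilon> \<in> {1, - 1}" "c \<noteq> 0" "y\<^sup>2 = poly branch_poly s"
    "v = (\<lambda>i. c * chart \<epsilon> s y i)"
proof -
  have cone: "(v 0)\<^sup>2 = (v 1)\<^sup>2 + (v 2)\<^sup>2" "(v 3)\<^sup>2 = (v 0)\<^sup>2 + (v 1)\<^sup>2"
    using v(3) by (auto simp: on_cone_def)
  \<comment> \<open>The chart is chosen such that \<open>v\<close> does not lie over its centre, where \<open>x\<^sub>0 = \<epsilon> x\<^sub>2\<close>.\<close>
  have "\<exists>\<epsilon>\<in>{1, - 1}. v 0 - \<epsilon> * v 2 \<noteq> 0"
  proof (rule ccontr)
    assume "\<not> ?thesis"
    then have "v 0 = v 2" "v 0 = - v 2" by (auto simp: eq_neg_iff_add_eq_0)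
    then have "v 0 = 0" "v 2 = 0" by (auto simp: equal_neg_zero)
    then have "v 1 = 0" "v 3 = 0" using cone by auto
    then have "v = 0" using v(1) \<open>v 0 = 0\<close> \<open>v 2 = 0\<close> by (intro vecs_3_eqI) (auto simp: vecs_def)
    then show False using v(2) by simp
  qed
  then obtain \<epsilon> where e: "\<epsilon> \<in> {1, - 1}" "v 0 - \<epsilon> * v 2 \<noteq> 0" by blast
  define c where "c = (v 0 - \<epsilon> * v 2) / 2"
  define s where "s = v 1 / (2 * c)"
  define y where "y = v 3 / c"
  have c: "c \<noteq> 0" using e by (simp add: c_def)
  have e2: "\<epsilon> * \<epsilon> = 1" using e by auto
  have v1: "v 1 = c * (2 * s)" and v3: "v 3 = c * y" using c by (simp_all add: s_def y_def)
  have c2: "2 * c = v 0 - \<epsilon> * v 2" by (simp add: c_def)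
  have "2 * c * (v 0 + \<epsilon> * v 2) = (v 0)\<^sup>2 - (\<epsilon> * \<epsilon>) * (v 2)\<^sup>2"
    unfolding c2 by (simp add: power2_eq_square algebra_simps)
  also have "\<dots> = (v 1)\<^sup>2" using cone e2 by simp
  also have "\<dots> = 2 * c * (2 * c * s\<^sup>2)" unfolding v1 by (simp add: power2_eq_square)
  finally have "2 * c * (v 0 + \<epsilon> * v 2) = 2 * c * (2 * c * s\<^sup>2)" .
  moreover have "2 * c \<noteq> 0" using c by simp
  ultimately have "v 0 + \<epsilon> * v 2 = 2 * c * s\<^sup>2" using mult_left_cancel by blast
  moreover have "v 0 - \<epsilon> * v 2 = 2 * c" by (simp add: c_def)
  moreover have "v 0 = ((v 0 + \<epsilon> * v 2) + (v 0 - \<epsilon> * v 2)) / 2"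
    "\<epsilon> * v 2 = ((v 0 + \<epsilon> * v 2) - (v 0 - \<epsilon> * v 2)) / 2" by simp_all
  ultimately have "v 0 = (2 * c * s\<^sup>2 + 2 * c) / 2" "\<epsilon> * v 2 = (2 * c * s\<^sup>2 - 2 * c) / 2"
    by simp_all
  then have v0: "v 0 = c * (s\<^sup>2 + 1)" and ev2: "\<epsilon> * v 2 = c * (s\<^sup>2 - 1)"
    by (simp_all add: add_divide_distrib diff_divide_distrib distrib_left right_diff_distrib)
  have "v 2 = \<epsilon> * (\<epsilon> * v 2)" using e2 by (simp flip: mult.assoc)
  then have v2: "v 2 = c * (\<epsilon> * (s\<^sup>2 - 1))" by (simp add: ev2)
  have "c\<^sup>2 * y\<^sup>2 = c\<^sup>2 * ((s\<^sup>2 + 1)\<^sup>2 + (2 * s)\<^sup>2)"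
    using cone(2) unfolding v0 v1 v3 unfolding power_mult_distrib unfolding distrib_left .
  then have "y\<^sup>2 = poly branch_poly s" using c by (simp add: poly_branch_poly)
  moreover have "v = (\<lambda>i. c * chart \<epsilon> s y i)"
    using v(1) by (intro vecs_3_eqI)
      (simp_all add: chart_def v0 v1 [unfolded One_nat_def] v2 v3 vecs_def vec4_def)
  ultimately show thesis using that e(1) c by blast
qed

lemma infinite_double_cover: "infinite {(s, y). y\<^sup>2 = poly branch_poly s \<and> s \<noteq> 0}"
proof
  assume "finite {(s, y). y\<^sup>2 = poly branch_poly s \<and> s \<noteq> 0}"
  then have "finite (fst ` {(s, y). y\<^sup>2 = poly branch_poly s \<and> s \<noteq> 0})" by (rule finite_imageI)
  moreover have "s \<in> fst ` {(s, y). y\<^sup>2 = poly branch_poly s \<and> s \<noteq> 0}" if "s \<noteq> 0" for s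
    using that by (intro image_eqI [of _ _ "(s, csqrt (poly branch_poly s))"]) auto
  ultimately have "finite (UNIV - {0 :: complex})"
    by (rule_tac finite_subset [OF subsetI]) auto
  then show False using infinite_UNIV_char_0 [where 'a = complex] by simp
qed

text \<open>
  On each chart a form becomes a regular function on the double cover.
\<close>

lemma form_zeros_on_chart:
  "finite {(s, y). y\<^sup>2 = poly branch_poly s \<and> peval G (chart \<epsilon> s y) = 0} \<or>
     (\<forall>s y. y\<^sup>2 = poly branch_poly s \<longrightarrow> peval G (chart \<epsilon> s y) = 0)"
proof -
  have "cover_fun branch_poly (\<lambda>s y. chart \<epsilon> s y i)" for i
  proof -
    consider "i = 0" | "i = 1" | "i = 2" | "i = 3" | "i > 3" using nat_cases_4 [of i] by blast
    then show ?thesis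
    proof cases
      case 1
      then show ?thesis using cover_fun_poly [of branch_poly "[:1, 0, 1:]"]
        by (simp add: chart_def power2_eq_square add.commute)
    next
      case 2
      then show ?thesis using cover_fun_poly [of branch_poly "[:0, 2:]"]
        by (simp add: chart_def mult.commute)
    next
      case 3
      then show ?thesis using cover_fun_poly [of branch_poly "[:- \<epsilon>, 0, \<epsilon>:]"]
        by (simp add: chart_def power2_eq_square algebra_simps)
    next
      case 4
      then show ?thesis using cover_fun_root by (simp add: chart_def)
    next
      case 5
      then show ?thesis using cover_fun_const by (simp add: chart_def vec4_def)
    qed
  qed
  then have "cover_fun branch_poly (\<lambda>s y. peval G (\<lambda>i. chart \<epsilon> s y i))" by (rule cover_fun_peval)
  moreover obtain r where "poly branch_poly r = 0" "poly (pderiv branch_poly) r \<noteq> 0"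
    by (rule branch_poly_simple_root)
  ultimately show ?thesis by (rule cover_fun_zeros)
qed

text \<open>
  The charts overlap in infinitely many points, so a form vanishing on one of them has infinitely
  many zeros on the other.
\<close>

lemma form_zero_on_both_charts:
  assumes G: "G \<in> forms 3" and all: "\<And>s y. y\<^sup>2 = poly branch_poly s \<Longrightarrow> peval G (chart \<epsilon> s y) = 0"
    and z: "z\<^sup>2 = poly branch_poly t"
  shows "peval G (chart (- \<epsilon>) t z) = 0"
proof -
  have "peval G (chart (- \<epsilon>) s y) = 0" if y: "y\<^sup>2 = poly branch_poly s" and s: "s \<noteq> 0" for s y
  proof -
    have "(y / s\<^sup>2)\<^sup>2 = poly branch_poly (1 / s)"
      using s unfolding power_divide y poly_branch_poly by (simp add: field_simps power2_eq_square)
    then have "peval G (chart \<epsilon> (1 / s) (y / s\<^sup>2)) = 0" by (rule all)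
    then have "peval G (\<lambda>i. s\<^sup>2 * chart \<epsilon> (1 / s) (y / s\<^sup>2) i) = 0"
      using s peval_form_scale [OF G] by simp
    moreover have "(\<lambda>i. s\<^sup>2 * chart \<epsilon> (1 / s) (y / s\<^sup>2) i) = chart (- \<epsilon>) s y"
      using s by (auto simp: chart_def vec4_def fun_eq_iff field_simps power2_eq_square)
    ultimately show ?thesis by simp
  qed
  then have "{(s, y). y\<^sup>2 = poly branch_poly s \<and> s \<noteq> 0} \<subseteq>
      {(s, y). y\<^sup>2 = poly branch_poly s \<and> peval G (chart (- \<epsilon>) s y) = 0}" by blast
  then have "infinite {(s, y). y\<^sup>2 = poly branch_poly s \<and> peval G (chart (- \<epsilon>) s y) = 0}"
    using infinite_double_cover finite_subset by blast
  then show ?thesis using form_zeros_on_chart z by blast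
qed

lemma finite_form_zeros_on_curve:
  assumes G: "G \<in> forms 3" and v: "v \<in> vecs 3" "v \<noteq> 0" "on_cone v" "peval G v \<noteq> 0"
  shows "finite {L \<in> two_oval_curve. \<forall>u\<in>L. peval G u = 0}"
proof -
  let ?Z = "\<lambda>\<epsilon>. {(s, y). y\<^sup>2 = poly branch_poly s \<and> peval G (chart \<epsilon> s y) = 0}"
  obtain \<delta> c t z where \<delta>: "\<delta> \<in> {1, - 1}" "c \<noteq> 0" "z\<^sup>2 = poly branch_poly t"
    "v = (\<lambda>i. c * chart \<delta> t z i)"
    by (rule chart_covers [OF v(1-3)])
  have nz: "peval G (chart \<delta> t z) \<noteq> 0"
    using v(4) unfolding \<delta>(4) peval_form_scale [OF G \<delta>(2)] .
  have "finite (?Z \<delta>)" using form_zeros_on_chart [of G \<delta>] nz \<delta>(3) by blast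
  moreover have "finite (?Z (- \<delta>))"
    using form_zeros_on_chart [of G "- \<delta>"] form_zero_on_both_charts [OF G, of "- \<delta>" z t] nz \<delta>(3) by auto
  ultimately have fin: "finite (?Z 1)" "finite (?Z (- 1))" using \<delta>(1) by auto
  have "{L \<in> two_oval_curve. \<forall>u\<in>L. peval G u = 0} \<subseteq>
      (\<Union>\<epsilon>\<in>{1, - 1}. (\<lambda>(s, y). line (chart \<epsilon> s y)) ` ?Z \<epsilon>)"
  proof
    fix L assume L: "L \<in> {L \<in> two_oval_curve. \<forall>u\<in>L. peval G u = 0}"
    then have "L \<in> two_oval_curve" by simp
    then obtain u where u: "u \<in> vecs 3" "u \<noteq> 0" "L = line u" "on_cone u" by (rule curve_pointE)
    obtain \<epsilon> c s y where \<epsilon>: "\<epsilon> \<in> {1, - 1}" "c \<noteq> 0" "y\<^sup>2 = poly branch_poly s"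
      "u = (\<lambda>i. c * chart \<epsilon> s y i)"
      by (rule chart_covers [OF u(1,2,4)])
    have "L = line (chart \<epsilon> s y)" unfolding u(3) \<epsilon>(4) by (rule line_scale [OF \<epsilon>(2)])
    moreover from this have "peval G (chart \<epsilon> s y) = 0" using L self_in_line by blast
    ultimately show "L \<in> (\<Union>\<epsilon>\<in>{1, - 1}. (\<lambda>(s, y). line (chart \<epsilon> s y)) ` ?Z \<epsilon>)"
      using \<epsilon>(1,3) by blast
  qed
  moreover have "finite (\<Union>\<epsilon>\<in>{1, - 1}. (\<lambda>(s, y). line (chart \<epsilon> s y)) ` ?Z \<epsilon>)"
    using fin by auto
  ultimately show ?thesis by (rule finite_subset)
qed

lemma infinite_curve: "infinite two_oval_curve"
proof
  assume fin: "finite two_oval_curve"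
  let ?f = "\<lambda>s. line (chart 1 s (csqrt (poly branch_poly s)))"
  have "inj ?f"
  proof (rule injI)
    fix s t assume "?f s = ?f t"
    then have "chart 1 s (csqrt (poly branch_poly s)) \<in> line (chart 1 t (csqrt (poly branch_poly t)))"
      by (rule line_eq_iff [THEN iffD1])
    then obtain c where "chart 1 s (csqrt (poly branch_poly s)) = (\<lambda>i. c * chart 1 t (csqrt (poly branch_poly t)) i)"
      unfolding line_def by blast
    then have c: "chart 1 s (csqrt (poly branch_poly s)) i = c * chart 1 t (csqrt (poly branch_poly t)) i" for i
      by simp
    have st: "s\<^sup>2 + 1 = c * (t\<^sup>2 + 1)" "s\<^sup>2 - 1 = c * (t\<^sup>2 - 1)" "s = c * t"
      using c [of 0] c [of 1] c [of 2] by (simp_all add: chart_def)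
    have "c * 2 = c * (t\<^sup>2 + 1) - c * (t\<^sup>2 - 1)" by (simp add: algebra_simps)
    also have "\<dots> = 2" unfolding st(1,2) [symmetric] by simp
    finally have "c = 1" by simp
    then show "s = t" using \<open>s = c * t\<close> by simp
  qed
  have "?f s \<in> two_oval_curve" for s
    using line_in_curve [OF chart_in_vecs chart_nonzero] chart_on_cone by simp
  then have "finite (range ?f)" by (intro finite_subset [OF _ fin]) blast
  then have "finite (UNIV :: complex set)" using \<open>inj ?f\<close> by (rule finite_imageD)
  then show False using infinite_UNIV_char_0 [where 'a = complex] by blast
qed

lemma cofinite_two_oval_curve: "cofinite_curve 3 two_oval_curve"
proof -
  have "finite Z" if Z: "zclosed 3 Z" "Z \<subset> two_oval_curve" for Z
  proof -
    obtain S where S: "S \<subseteq> forms 3" "Z = zero_set 3 S" using Z(1) by (auto simp: zclosed_def)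
    obtain L where L: "L \<in> two_oval_curve" "L \<notin> Z" using Z(2) by blast
    obtain v where v: "v \<in> vecs 3" "v \<noteq> 0" "L = line v" "on_cone v"
      by (rule curve_pointE [OF L(1)])
    then obtain G where G: "G \<in> S" "peval G v \<noteq> 0"
      using L(2) line_in_zero_set [OF S(1) v(1,2)] S(2) by blast
    have "Z \<subseteq> {L \<in> two_oval_curve. \<forall>u\<in>L. peval G u = 0}"
      using Z(2) G(1) S(2) by (auto simp: zero_set_def)
    moreover have "finite {L \<in> two_oval_curve. \<forall>u\<in>L. peval G u = 0}"
      using finite_form_zeros_on_curve v G S(1) by blast
    ultimately show ?thesis by (rule finite_subset)
  qed
  then show ?thesis using zclosed_curve infinite_curve by (simp add: cofinite_curve_def)
qed

section \<open>Smoothness of the curve\<close>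

text \<open>
  A plane on which two of the coordinates \<open>i\<close> and \<open>j\<close> serve as parameters has a basis dual to them.
\<close>

lemma dim_parametrized_plane:
  fixes p q :: "nat \<Rightarrow> complex"
  assumes "p i = 1" "p j = 0" "q i = 0" "q j = 1" "p \<in> T" "q \<in> T"
    and T: "\<And>w. w \<in> T \<Longrightarrow> w = (\<lambda>l. w i * p l + w j * q l)"
  shows "vector_space.dim (\<lambda>c u l. c * u l) T = 2"
proof -
  interpret vector_space "\<lambda>(c::complex) (u::nat \<Rightarrow> complex) l. c * u l"
    by unfold_locales (auto simp: algebra_simps fun_eq_iff)
  have "p \<noteq> q" using assms by auto
  have "q \<noteq> 0" using assms(4) by auto
  have "p \<notin> span {q}"
  proof
    assume "p \<in> span {q}"
    then obtain k where "p = (\<lambda>l. k * q l)" by (auto simp: span_singleton)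
    then have "p i = k * q i" by simp
    then show False using assms(1,3) by simp
  qed
  then have "independent {p, q}"
    using \<open>q \<noteq> 0\<close> by (intro independent_insertI independent_empty) auto
  moreover have "T \<subseteq> span {p, q}"
  proof
    fix w assume "w \<in> T"
    then have eq: "w = (\<lambda>l. w i * p l) + (\<lambda>l. w j * q l)"
      unfolding plus_fun_def by (rule T)
    have "(\<lambda>l. w i * p l) + (\<lambda>l. w j * q l) \<in> span {p, q}"
      by (rule span_add; rule span_scale; rule span_base; simp)
    then show "w \<in> span {p, q}" by (subst eq)
  qed
  ultimately show ?thesis
    using assms(5,6) \<open>p \<noteq> q\<close> by (intro dim_unique [of "{p, q}"]) auto
qed

text \<open>
  The common kernel of the differentials of the two equations at \<open>v\<close>.
\<close>

definition tangent_vectors :: "(nat \<Rightarrow> complex) \<Rightarrow> (nat \<Rightarrow> complex) set" where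
  "tangent_vectors v = {w \<in> vecs 3. v 0 * w 0 = v 1 * w 1 + v 2 * w 2 \<and> v 3 * w 3 = v 0 * w 0 + v 1 * w 1}"

text \<open>
  Any two of the squared coordinates determine the other two, by the linear equations
  \<open>x\<^sub>0\<^sup>2 = x\<^sub>1\<^sup>2 + x\<^sub>2\<^sup>2\<close> and \<open>x\<^sub>3\<^sup>2 = x\<^sub>0\<^sup>2 + x\<^sub>1\<^sup>2\<close>. This nondegeneracy is the reason for smoothness.
\<close>

lemma on_cone_zeros:
  assumes "v \<in> vecs 3" "v \<noteq> 0" "on_cone v" "i \<le> 3" "j \<le> 3" "v i = 0" "v j = 0"
  shows "i = j"
proof (rule ccontr)
  assume "i \<noteq> j"
  have cone: "(v 0)\<^sup>2 = (v 1)\<^sup>2 + (v 2)\<^sup>2" "(v 3)\<^sup>2 = (v 0)\<^sup>2 + (v 1)\<^sup>2"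
    using assms(3) by (auto simp: on_cone_def)
  have "i \<in> {0, 1, 2, 3}" "j \<in> {0, 1, 2, 3}" using assms(4,5) by auto
  then have "v 0 = 0 \<and> v 1 = 0 \<or> v 0 = 0 \<and> v 2 = 0 \<or> v 0 = 0 \<and> v 3 = 0 \<or>
      v 1 = 0 \<and> v 2 = 0 \<or> v 1 = 0 \<and> v 3 = 0 \<or> v 2 = 0 \<and> v 3 = 0"
    using \<open>i \<noteq> j\<close> assms(6,7) by auto
  then have "v 0 = 0 \<and> v 1 = 0"
    using cone by (elim disjE conjE) simp_all
  then have "v 0 = 0" "v 1 = 0" "v 2 = 0" "v 3 = 0" using cone by simp_all
  then have "v = 0" using assms(1) by (intro vecs_3_eqI) (auto simp: vecs_def)
  then show False using assms(2) by simp
qed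

text \<open>
  Two coordinates whose complementary coordinates of \<open>v\<close> do not vanish can serve as parameters; the
  choice depends on which coordinate of \<open>v\<close> is zero.
\<close>

lemma dim_tangent_vectors:
  assumes v: "v \<in> vecs 3" "v \<noteq> 0" "on_cone v"
  shows "vector_space.dim (\<lambda>c u l. c * u l) (tangent_vectors v) = 2"
proof -
  note z = on_cone_zeros [OF v]
  consider "v 2 \<noteq> 0" "v 3 \<noteq> 0" | "v 2 = 0" | "v 3 = 0" by blast
  then show ?thesis
  proof cases
    case 1
    show ?thesis
    proof (rule dim_parametrized_plane)
      show "vec4 1 0 (v 0 / v 2) (v 0 / v 3) \<in> tangent_vectors v"
        "vec4 0 1 (- v 1 / v 2) (v 1 / v 3) \<in> tangent_vectors v"
        using 1 by (simp_all add: tangent_vectors_def)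
      fix w assume w: "w \<in> tangent_vectors v"
      then have "w 2 = w 0 * (v 0 / v 2) + w 1 * (- v 1 / v 2)" "w 3 = w 0 * (v 0 / v 3) + w 1 * (v 1 / v 3)"
        using 1 by (simp_all add: tangent_vectors_def field_simps)
      then show "w = (\<lambda>l. w 0 * vec4 1 0 (v 0 / v 2) (v 0 / v 3) l + w 1 * vec4 0 1 (- v 1 / v 2) (v 1 / v 3) l)"
        using w by (intro vecs_3_eqI) (simp_all add: tangent_vectors_def vecs_def vec4_def)
    qed simp_all
  next
    case 2
    then have nz: "v 1 \<noteq> 0" "v 3 \<noteq> 0" using z [of 1 2] z [of 3 2] by auto
    show ?thesis
    proof (rule dim_parametrized_plane)
      show "vec4 1 (v 0 / v 1) 0 (2 * v 0 / v 3) \<in> tangent_vectors v" "vec4 0 0 1 0 \<in> tangent_vectors v"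
        using nz 2 by (simp_all add: tangent_vectors_def)
      fix w assume w: "w \<in> tangent_vectors v"
      then have e: "v 1 * w 1 = v 0 * w 0" "v 3 * w 3 = 2 * (v 0 * w 0)" using 2 by (simp_all add: tangent_vectors_def)
      then have "w 1 = w 0 * (v 0 / v 1)" "w 3 = w 0 * (2 * v 0 / v 3)"
        using nz by (simp_all add: field_simps)
      then show "w = (\<lambda>l. w 0 * vec4 1 (v 0 / v 1) 0 (2 * v 0 / v 3) l + w 2 * vec4 0 0 1 0 l)"
        using w by (intro vecs_3_eqI) (simp_all add: tangent_vectors_def vecs_def vec4_def)
    qed simp_all
  next
    case 3
    then have nz: "v 1 \<noteq> 0" "v 2 \<noteq> 0" using z [of 1 3] z [of 2 3] by auto
    show ?thesis
    proof (rule dim_parametrized_plane)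
      show "vec4 1 (- v 0 / v 1) (2 * v 0 / v 2) 0 \<in> tangent_vectors v" "vec4 0 0 0 1 \<in> tangent_vectors v"
        using nz 3 by (simp_all add: tangent_vectors_def)
      fix w assume w: "w \<in> tangent_vectors v"
      then have e: "v 0 * w 0 = v 1 * w 1 + v 2 * w 2" "0 * w 3 = v 0 * w 0 + v 1 * w 1"
        unfolding tangent_vectors_def 3 by blast+
      have "v 1 * w 1 = - (v 0 * w 0)" using e(2) by (intro minus_unique [symmetric]) simp
      moreover from this have "v 2 * w 2 = 2 * (v 0 * w 0)" using e(1) by simp
      ultimately have "w 1 = w 0 * (- v 0 / v 1)" "w 2 = w 0 * (2 * v 0 / v 2)"
        using nz by (simp_all add: field_simps)
      then show "w = (\<lambda>l. w 0 * vec4 1 (- v 0 / v 1) (2 * v 0 / v 2) 0 l + w 3 * vec4 0 0 0 1 l)"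
        using w by (intro vecs_3_eqI) (simp_all add: tangent_vectors_def vecs_def vec4_def)
    qed simp_all
  qed
qed

lemma cone_tangent_space_subset:
  "cone_tangent_space 3 two_oval_curve v \<subseteq> tangent_vectors v"
proof
  fix w assume w: "w \<in> cone_tangent_space 3 two_oval_curve v"
  have d: "deriv (\<lambda>z. peval F (\<lambda>i. v i + z * w i)) 0 = 0" if "F \<in> {circle_form, sheet_form}" for F
  proof -
    have "\<forall>L\<in>two_oval_curve. \<forall>u\<in>L. peval F u = 0"
      using that by (auto simp: two_oval_curve_def zero_set_def)
    then show ?thesis using w that curve_forms unfolding cone_tangent_space_def by blast
  qed
  have two: "2 * x = 0 \<Longrightarrow> x = 0" for x :: complex by simp
  have "((\<lambda>z. peval circle_form (\<lambda>i. v i + z * w i)) has_field_derivative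
      2 * (v 1 * w 1 + v 2 * w 2 - v 0 * w 0)) (at 0)"
    unfolding peval_circle_form by (auto intro!: derivative_eq_intros simp: algebra_simps)
  then have "2 * (v 1 * w 1 + v 2 * w 2 - v 0 * w 0) = deriv (\<lambda>z. peval circle_form (\<lambda>i. v i + z * w i)) 0"
    by (rule DERIV_imp_deriv [symmetric])
  also have "\<dots> = 0" by (rule d) simp
  finally have circle: "v 1 * w 1 + v 2 * w 2 - v 0 * w 0 = 0" by (rule two)
  have "((\<lambda>z. peval sheet_form (\<lambda>i. v i + z * w i)) has_field_derivative
      2 * (v 0 * w 0 + v 1 * w 1 - v 3 * w 3)) (at 0)"
    unfolding peval_sheet_form by (auto intro!: derivative_eq_intros simp: algebra_simps)
  then have "2 * (v 0 * w 0 + v 1 * w 1 - v 3 * w 3) = deriv (\<lambda>z. peval sheet_form (\<lambda>i. v i + z * w i)) 0"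
    by (rule DERIV_imp_deriv [symmetric])
  also have "\<dots> = 0" by (rule d) simp
  finally have sheet: "v 0 * w 0 + v 1 * w 1 - v 3 * w 3 = 0" by (rule two)
  show "w \<in> tangent_vectors v"
    using w circle sheet unfolding tangent_vectors_def cone_tangent_space_def by simp
qed

text \<open>
  The equations are linear in the squares of the coordinates. So an arc stays in the cone if its
  squared coordinates are \<open>v\<^sub>i\<^sup>2 + 2 v\<^sub>i w\<^sub>i x + \<mu>\<^sub>i x\<^sup>2\<close>, where the linear term solves the linear
  equations because \<open>w\<close> is in the kernel of the differentials, and \<open>\<mu>\<close> is any solution of them. Where
  \<open>v\<^sub>i \<noteq> 0\<close> the coordinate itself is a square root of this, holomorphic near 0; where \<open>v\<^sub>i = 0\<close> the
  coordinate is \<open>w\<^sub>i x\<close>, which prescribes \<open>\<mu>\<^sub>i = w\<^sub>i\<^sup>2\<close>. At most one coordinate is of the second kind.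
\<close>

lemma tangent_vectors_subset:
  assumes v: "v \<in> vecs 3" "v \<noteq> 0" "on_cone v"
  shows "tangent_vectors v \<subseteq> cone_tangent_space 3 two_oval_curve v"
proof
  fix w assume w: "w \<in> tangent_vectors v"
  note z = on_cone_zeros [OF v]
  obtain \<mu> :: "nat \<Rightarrow> complex" where \<mu>: "\<mu> 0 = \<mu> 1 + \<mu> 2" "\<mu> 3 = \<mu> 0 + \<mu> 1"
    and \<mu>0: "\<And>k. k \<le> 3 \<Longrightarrow> v k = 0 \<Longrightarrow> \<mu> k = (w k)\<^sup>2"
  proof (cases "\<exists>k\<le>3. v k = 0")
    case False
    then show ?thesis using that [of "\<lambda>_. 0"] by auto
  next
    case True
    then obtain k where k: "k \<le> 3" "v k = 0" by blast
    then have only: "i = k" if "i \<le> 3" "v i = 0" for i using z that by blast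
    let ?a = "(w k)\<^sup>2"
    show ?thesis
    proof (cases "k = 1")
      case True
      show ?thesis
        by (rule that [of "vec4 0 ?a (- ?a) ?a"]) (use only True in force)+
    next
      case False
      then have "k \<in> {0, 2, 3}" using k(1) by auto
      then show ?thesis
        by (intro that [of "vec4 ?a 0 ?a ?a"]) (use only in force)+
    qed
  qed
  define \<gamma> where "\<gamma> i x = (if v i = 0 then w i * x
      else v i * csqrt (1 + (2 * v i * w i * x + \<mu> i * x\<^sup>2) / (v i)\<^sup>2))" for i x
  have \<gamma>0: "\<gamma> i 0 = v i" for i by (simp add: \<gamma>_def)
  have d\<gamma>: "(\<gamma> i has_field_derivative w i) (at 0)" for i
  proof (cases "v i = 0")
    case True
    then show ?thesis unfolding \<gamma>_def by (auto intro!: derivative_eq_intros)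
  next
    case False
    then show ?thesis unfolding \<gamma>_def
      by (auto intro!: derivative_eq_intros simp: power2_eq_square)
  qed
  have sq: "(\<gamma> i x)\<^sup>2 = (v i)\<^sup>2 + 2 * (v i * w i) * x + \<mu> i * x\<^sup>2" if "i \<le> 3" for i x
    using \<mu>0 [OF that] by (auto simp: \<gamma>_def power_mult_distrib field_simps)
  have cone: "on_cone (\<lambda>i. \<gamma> i x)" for x
  proof -
    have c: "(v 0)\<^sup>2 = (v 1)\<^sup>2 + (v 2)\<^sup>2" "(v 3)\<^sup>2 = (v 0)\<^sup>2 + (v 1)\<^sup>2"
      using v(3) by (simp_all only: on_cone_def)
    have t: "v 0 * w 0 = v 1 * w 1 + v 2 * w 2" "v 3 * w 3 = v 0 * w 0 + v 1 * w 1"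
      using w by (simp_all only: tangent_vectors_def mem_Collect_eq)
    have s: "(\<gamma> 0 x)\<^sup>2 = (v 0)\<^sup>2 + 2 * (v 0 * w 0) * x + \<mu> 0 * x\<^sup>2"
      "(\<gamma> 1 x)\<^sup>2 = (v 1)\<^sup>2 + 2 * (v 1 * w 1) * x + \<mu> 1 * x\<^sup>2"
      "(\<gamma> 2 x)\<^sup>2 = (v 2)\<^sup>2 + 2 * (v 2 * w 2) * x + \<mu> 2 * x\<^sup>2"
      "(\<gamma> 3 x)\<^sup>2 = (v 3)\<^sup>2 + 2 * (v 3 * w 3) * x + \<mu> 3 * x\<^sup>2"
      by (rule sq, simp)+
    have "(\<gamma> 0 x)\<^sup>2 = (\<gamma> 1 x)\<^sup>2 + (\<gamma> 2 x)\<^sup>2"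
      unfolding s c(1) t(1) \<mu>(1) by (simp only: distrib_left distrib_right ac_simps)
    moreover have "(\<gamma> 3 x)\<^sup>2 = (\<gamma> 0 x)\<^sup>2 + (\<gamma> 1 x)\<^sup>2"
      unfolding s c(2) t(2) \<mu>(2) by (simp only: distrib_left distrib_right ac_simps)
    ultimately show ?thesis by (simp only: on_cone_def)
  qed
  have vecs: "(\<lambda>i. \<gamma> i x) \<in> vecs 3" for x
    using v(1) w by (auto simp: vecs_def \<gamma>_def tangent_vectors_def)
  obtain k where k: "v k \<noteq> 0" using v(2) by (auto simp: fun_eq_iff)
  have "(\<gamma> k \<longlongrightarrow> \<gamma> k 0) (nhds 0)"
    using DERIV_isCont [OF d\<gamma> [of k]] unfolding isCont_def tendsto_at_iff_tendsto_nhds .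
  then have ev: "\<forall>\<^sub>F x in nhds 0. \<gamma> k x \<noteq> 0"
    using k unfolding \<gamma>0 by (rule tendsto_imp_eventually_ne)
  have "deriv (\<lambda>x. peval F (\<lambda>i. v i + x * w i)) 0 = 0"
    if F: "F \<in> forms 3" "\<forall>L\<in>two_oval_curve. \<forall>u\<in>L. peval F u = 0" for F
  proof (rule deriv_peval_along_curve [OF \<gamma>0 d\<gamma>])
    show "\<forall>\<^sub>F x in nhds 0. peval F (\<lambda>i. \<gamma> i x) = 0"
      using ev
    proof eventually_elim
      case (elim x)
      then have "(\<lambda>i. \<gamma> i x) \<noteq> 0" by (auto simp: fun_eq_iff)
      then have "line (\<lambda>i. \<gamma> i x) \<in> two_oval_curve" using line_in_curve vecs cone by blast
      then show ?case using F(2) self_in_line by blast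
    qed
  qed
  then show "w \<in> cone_tangent_space 3 two_oval_curve v"
    using w unfolding cone_tangent_space_def tangent_vectors_def by blast
qed

lemma smooth_two_oval_curve: "smooth 3 two_oval_curve"
  unfolding smooth_def
proof (intro ballI)
  fix L v assume L: "L \<in> two_oval_curve" "v \<in> L"
  note v = curve_pointD [OF L]
  have "cone_tangent_space 3 two_oval_curve v = tangent_vectors v"
    using cone_tangent_space_subset tangent_vectors_subset [OF v(1,2,4)] by blast
  then show "enat (vector_space.dim (\<lambda>c u i. c * u i) (cone_tangent_space 3 two_oval_curve v)) =
      local_dim 3 two_oval_curve L + 1"
    using dim_tangent_vectors [OF v(1,2,4)] local_dim_cofinite_curve [OF cofinite_two_oval_curve L(1)]
    by (simp add: one_enat_def)
qed

section \<open>The two ovals\<close>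

definition oval :: "real \<Rightarrow> real \<Rightarrow> point" where
  "oval \<delta> t = line (vec4 1 (of_real (cos (2 * pi * t))) (of_real (sin (2 * pi * t)))
     (of_real (\<delta> * sqrt (1 + (cos (2 * pi * t))\<^sup>2))))"

text \<open>
  The function \<open>(x\<^sub>1 + i x\<^sub>2)/x\<^sub>0\<close> where \<open>x\<^sub>3/x\<^sub>0\<close> has the sign \<open>\<epsilon>\<close>, and 1 where it has the opposite
  sign. Writing the case distinction with the sign function makes continuity automatic away from
  \<open>Re (x\<^sub>3/x\<^sub>0) = 0\<close>.
\<close>

definition angle_vec :: "real \<Rightarrow> (nat \<Rightarrow> complex) \<Rightarrow> complex" where
  "angle_vec \<epsilon> v = 1 + ((v 1 + \<i> * v 2) / v 0 - 1) * of_real ((1 + sgn (\<epsilon> * Re (v 3 / v 0))) / 2)"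

definition angle_map :: "real \<Rightarrow> point \<Rightarrow> complex" where
  "angle_map \<epsilon> L = angle_vec \<epsilon> (SOME v. v \<in> L)"

lemma angle_vec_scale: "c \<noteq> 0 \<Longrightarrow> angle_vec \<epsilon> (\<lambda>i. c * v i) = angle_vec \<epsilon> v"
  by (simp add: angle_vec_def mult.left_commute [of \<i>] flip: distrib_left)

lemma angle_vec_pos:
  assumes "sgn (\<epsilon> * Re (v 3 / v 0)) = 1"
  shows "angle_vec \<epsilon> v = (v 1 + \<i> * v 2) / v 0"
proof -
  have "complex_of_real ((1 + sgn (\<epsilon> * Re (v 3 / v 0))) / 2) = 1" unfolding assms by simp
  then show ?thesis unfolding angle_vec_def by simp
qed

lemma angle_vec_neg:
  assumes "sgn (\<epsilon> * Re (v 3 / v 0)) = - 1"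
  shows "angle_vec \<epsilon> v = 1"
  unfolding angle_vec_def assms by simp

lemma angle_map_line: "angle_map \<epsilon> (line v) = angle_vec \<epsilon> v"
proof -
  have "(SOME w. w \<in> line v) \<in> line v"
    using someI [of "\<lambda>w. w \<in> line v", OF self_in_line] .
  then show ?thesis
    unfolding angle_map_def line_def [of v] by (auto simp: angle_vec_scale)
qed

text \<open>
  For real coordinates the equations force \<open>x\<^sub>0 \<noteq> 0\<close> and \<open>x\<^sub>3\<^sup>2 = x\<^sub>0\<^sup>2 + x\<^sub>1\<^sup>2 > 0\<close>.
\<close>

lemma real_point_of_curve:
  assumes "L \<in> real_points two_oval_curve"
  obtains v where "v \<in> vecs 3" "v \<noteq> 0" "L = line v" "on_cone v" "v 0 \<noteq> 0" "Re (v 3 / v 0) \<noteq> 0"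
proof -
  obtain v where v: "v \<in> L" "\<And>i. v i \<in> \<real>" and L: "L \<in> two_oval_curve"
    using assms by (auto simp: real_points_def)
  note w = curve_pointD [OF L v(1)]
  have "\<forall>i. \<exists>x. v i = of_real x" using v(2) by (auto simp: Reals_def)
  then obtain x where x: "\<And>i. v i = complex_of_real (x i)" by metis
  have "complex_of_real ((x 0)\<^sup>2) = complex_of_real ((x 1)\<^sup>2 + (x 2)\<^sup>2)"
    "complex_of_real ((x 3)\<^sup>2) = complex_of_real ((x 0)\<^sup>2 + (x 1)\<^sup>2)"
    using w(4) by (simp_all add: on_cone_def x)
  then have c: "(x 0)\<^sup>2 = (x 1)\<^sup>2 + (x 2)\<^sup>2" "(x 3)\<^sup>2 = (x 0)\<^sup>2 + (x 1)\<^sup>2"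
    unfolding of_real_eq_iff by simp_all
  have x0: "x 0 \<noteq> 0"
  proof
    assume "x 0 = 0"
    then have "x 1 = 0" "x 2 = 0" "x 3 = 0" using c by (simp_all add: sum_power2_eq_zero_iff)
    then have "v = 0" using w(1) \<open>x 0 = 0\<close> by (intro vecs_3_eqI) (simp_all add: x vecs_def)
    then show False using w(2) by simp
  qed
  have "x 3 \<noteq> 0"
  proof
    assume "x 3 = 0"
    then have "(x 0)\<^sup>2 + (x 1)\<^sup>2 = 0" using c(2) by simp
    then show False using x0 by (simp add: sum_power2_eq_zero_iff)
  qed
  then have "v 0 \<noteq> 0" "Re (v 3 / v 0) \<noteq> 0" using x0 by (simp_all add: x flip: of_real_divide)
  then show thesis using that w by blast
qed

lemma angle_vec_nonzero:
  assumes "on_cone v" "v 0 \<noteq> 0" "Re (v 3 / v 0) \<noteq> 0" "\<epsilon> \<noteq> 0"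
  shows "angle_vec \<epsilon> v \<noteq> 0"
proof -
  have "(v 1 + \<i> * v 2) * (v 1 - \<i> * v 2) = (v 1)\<^sup>2 + (v 2)\<^sup>2"
    by (simp add: power2_eq_square algebra_simps)
  also have "\<dots> = (v 0)\<^sup>2" using assms(1) by (simp add: on_cone_def)
  finally have "v 1 + \<i> * v 2 \<noteq> 0" using assms(2) by auto
  moreover have "sgn (\<epsilon> * Re (v 3 / v 0)) = 1 \<or> sgn (\<epsilon> * Re (v 3 / v 0)) = - 1"
    using assms(3,4) by (auto simp: sgn_if)
  ultimately show ?thesis using assms(2) angle_vec_pos [of \<epsilon> v] angle_vec_neg [of \<epsilon> v] by auto
qed

lemma topspace_pspace_topology: "topspace (pspace_topology N) = pspace N"
  by (simp add: pspace_topology_def topspace_quotient_topology pspace_def)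

lemma topspace_real_locus: "zclosed N Z \<Longrightarrow> topspace (real_locus N Z) = real_points Z"
  using zclosed_subset_pspace by (force simp: real_locus_def topspace_pspace_topology real_points_def)

lemma quotient_map_line: "quotient_map (top_of_set (vecs N - {0})) (pspace_topology N) line"
  unfolding pspace_topology_def by (rule quotient_map_quotient_topology)

text \<open>
  A quotient map need not stay one on an arbitrary subspace. Therefore continuity is first shown
  on the open set \<open>W\<close> of complex points with \<open>x\<^sub>0 \<noteq> 0\<close> and \<open>Re (x\<^sub>3/x\<^sub>0) \<noteq> 0\<close>, and then restricted to
  the real locus.
\<close>

lemma continuous_angle_map:
  assumes "\<epsilon> \<noteq> 0"
  shows "continuous_map (real_locus 3 two_oval_curve) (top_of_set (- {0})) (angle_map \<epsilon>)"
proof -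
  define D where "D = {v \<in> vecs 3 - {0}. v 0 \<noteq> 0 \<and> Re (v 3 / v 0) \<noteq> 0}"
  define W where "W = line ` D"
  have sat: "{v \<in> vecs 3 - {0}. line v \<in> W} = D"
  proof
    show "D \<subseteq> {v \<in> vecs 3 - {0}. line v \<in> W}" by (auto simp: D_def W_def)
    show "{v \<in> vecs 3 - {0}. line v \<in> W} \<subseteq> D"
    proof
      fix v assume "v \<in> {v \<in> vecs 3 - {0}. line v \<in> W}"
      then have v: "v \<in> vecs 3 - {0}" "line v \<in> W" by auto
      then obtain u where u: "u \<in> D" "line v = line u" by (auto simp: W_def)
      then have "v \<in> line u" using self_in_line by metis
      then obtain c where "c \<noteq> 0" "v = (\<lambda>i. c * u i)" by (auto simp: line_def)
      then show "v \<in> D" using u(1) v(1) by (simp add: D_def)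
    qed
  qed
  have coord: "continuous_on S (\<lambda>v :: nat \<Rightarrow> complex. v i)" for S i
    by (rule continuous_on_subset [OF continuous_on_product_coordinates]) simp
  have "openin (top_of_set (vecs 3 - {0})) D"
  proof -
    let ?f = "\<lambda>v :: nat \<Rightarrow> complex. cmod (v 0) * Re (v 3 * cnj (v 0))"
    \<comment> \<open>The defining function of \<open>D\<close> is replaced by one without a division.\<close>
    have "Re (v 3 / v 0) = Re (v 3 * cnj (v 0)) / (cmod (v 0))\<^sup>2" for v :: "nat \<Rightarrow> complex"
      by (simp add: complex_div_cnj [of "v 3"] flip: of_real_power)
    then have "D = (vecs 3 - {0}) \<inter> ?f -` (- {0})" unfolding D_def by auto
    moreover have "continuous_on (vecs 3 - {0}) ?f" by (intro continuous_intros coord)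
    then have "openin (top_of_set (vecs 3 - {0})) ((vecs 3 - {0}) \<inter> ?f -` (- {0}))"
      by (rule continuous_openin_preimage_gen) (simp add: open_Compl)
    ultimately show ?thesis by (simp only:)
  qed
  then have "openin (pspace_topology 3) W"
    unfolding pspace_topology_def openin_quotient_topology using sat by (auto simp: W_def D_def)
  then have quo: "quotient_map (subtopology (top_of_set (vecs 3 - {0})) D)
      (subtopology (pspace_topology 3) W) line"
    using sat by (intro quotient_map_restriction [OF quotient_map_line]) auto
  have "continuous_on D (angle_vec \<epsilon>)"
    unfolding angle_vec_def
    by (intro continuous_intros coord) (use assms in \<open>auto simp: D_def\<close>)
  then have "continuous_on D (angle_map \<epsilon> \<circ> line)"
    by (simp add: o_def angle_map_line)
  moreover have "(vecs 3 - {0}) \<inter> D = D" by (auto simp: D_def)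
  ultimately have "continuous_map (subtopology (top_of_set (vecs 3 - {0})) D) euclidean (angle_map \<epsilon> \<circ> line)"
    by (simp add: subtopology_subtopology)
  then have cont: "continuous_map (subtopology (pspace_topology 3) W) euclidean (angle_map \<epsilon>)"
    by (rule continuous_compose_quotient_map [OF quo])
  have "real_points two_oval_curve \<subseteq> W"
  proof
    fix L assume "L \<in> real_points two_oval_curve"
    then obtain v where "v \<in> vecs 3" "v \<noteq> 0" "L = line v" "v 0 \<noteq> 0" "Re (v 3 / v 0) \<noteq> 0"
      by (rule real_point_of_curve)
    then show "L \<in> W" by (auto simp: W_def D_def)
  qed
  then have "continuous_map (real_locus 3 two_oval_curve) euclidean (angle_map \<epsilon>)"
    unfolding real_locus_def using continuous_map_from_subtopology_mono [OF cont] by blast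
  moreover have "angle_map \<epsilon> L \<noteq> 0" if "L \<in> real_points two_oval_curve" for L
    using that angle_vec_nonzero [OF _ _ _ assms] by (metis angle_map_line real_point_of_curve)
  ultimately show ?thesis
    by (auto simp: continuous_map_in_subtopology topspace_real_locus [OF zclosed_curve])
qed

lemma continuous_oval:
  assumes "\<delta>\<^sup>2 = 1"
  shows "continuous_map (top_of_set {0..1}) (real_locus 3 two_oval_curve) (oval \<delta>)"
proof -
  define u where "u t = vec4 1 (of_real (cos (2 * pi * t))) (of_real (sin (2 * pi * t)))
     (of_real (\<delta> * sqrt (1 + (cos (2 * pi * t))\<^sup>2)))" for t
  have u: "u t \<in> vecs 3" "u t \<noteq> 0" for t
    by (simp add: u_def) (metis u_def vec4_simps(1) zero_fun_apply zero_neq_one)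
  have "continuous_on {0..1} (\<lambda>t. u t i)" for i
    unfolding u_def vec4_def
    by (cases "i = 0"; cases "i = 1"; cases "i = 2"; cases "i = 3") (auto intro!: continuous_intros)
  then have "continuous_on {0..1} u" by (rule continuous_on_coordinatewise_then_product)
  then have "continuous_map (top_of_set {0..1}) (top_of_set (vecs 3 - {0})) u"
    using u by (auto simp: continuous_map_in_subtopology)
  then have "continuous_map (top_of_set {0..1}) (pspace_topology 3) (line \<circ> u)"
    by (rule continuous_map_compose [OF _ quotient_imp_continuous_map [OF quotient_map_line]])
  moreover have "line \<circ> u = oval \<delta>" by (rule ext) (simp only: u_def oval_def o_def)
  moreover have "oval \<delta> t \<in> real_points two_oval_curve" for t
  proof -
    have s: "(complex_of_real (sqrt (1 + (cos (2 * pi * t))\<^sup>2)))\<^sup>2 = 1 + (complex_of_real (cos (2 * pi * t)))\<^sup>2"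
    proof -
      have "(sqrt (1 + (cos (2 * pi * t))\<^sup>2))\<^sup>2 = 1 + (cos (2 * pi * t))\<^sup>2" by (simp add: add_nonneg_nonneg)
      then have "complex_of_real ((sqrt (1 + (cos (2 * pi * t))\<^sup>2))\<^sup>2) = complex_of_real (1 + (cos (2 * pi * t))\<^sup>2)"
        by (rule arg_cong)
      then show ?thesis by (simp only: of_real_power of_real_add of_real_1)
    qed
    have "complex_of_real ((cos (2 * pi * t))\<^sup>2 + (sin (2 * pi * t))\<^sup>2) = complex_of_real 1"
      by (rule arg_cong) (rule sin_cos_squared_add2)
    then have "(complex_of_real (cos (2 * pi * t)))\<^sup>2 + (complex_of_real (sin (2 * pi * t)))\<^sup>2 = 1"
      by (simp only: of_real_power of_real_add of_real_1)
    moreover have "complex_of_real (\<delta>\<^sup>2) = complex_of_real 1" using assms by (rule arg_cong)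
    then have "(complex_of_real \<delta>)\<^sup>2 = 1" by (simp only: of_real_power of_real_1)
    ultimately have "on_cone (u t)"
      using s by (simp add: on_cone_def u_def power_mult_distrib)
    then have "line (u t) \<in> two_oval_curve" using line_in_curve u by blast
    moreover have "u t i \<in> \<real>" for i by (auto simp: u_def vec4_def)
    ultimately show ?thesis
      unfolding real_points_def using self_in_line [of "u t"] by (auto simp: oval_def u_def)
  qed
  ultimately show ?thesis
    unfolding real_locus_def by (auto simp: continuous_map_in_subtopology)
qed

lemma angle_map_oval:
  assumes "\<epsilon> \<in> {1, - 1}" "\<delta> \<in> {1, - 1}"
  shows "angle_map \<epsilon> (oval \<delta> t) = (if \<epsilon> = \<delta> then exp (2 * of_real pi * \<i> * of_real t) else 1)"
proof -
  have pos: "sqrt (1 + (cos (2 * pi * t))\<^sup>2) > 0" by (simp add: add_pos_nonneg)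
  then have sgn: "sgn (\<epsilon> * (\<delta> * sqrt (1 + (cos (2 * pi * t))\<^sup>2))) = (if \<epsilon> = \<delta> then 1 else - 1)"
    using assms by (auto simp: sgn_mult)
  have cs: "of_real (cos (2 * pi * t)) + \<i> * of_real (sin (2 * pi * t)) = exp (2 * of_real pi * \<i> * of_real t)"
    using cis_conv_exp [of "2 * pi * t"] by (simp add: cis.code complex_eq_iff mult_ac)
  define w where "w = vec4 1 (of_real (cos (2 * pi * t))) (of_real (sin (2 * pi * t)))
     (of_real (\<delta> * sqrt (1 + (cos (2 * pi * t))\<^sup>2)))"
  have "Re (w 3 / w 0) = \<delta> * sqrt (1 + (cos (2 * pi * t))\<^sup>2)"
    by (simp add: w_def del: of_real_mult)
  then have sw: "sgn (\<epsilon> * Re (w 3 / w 0)) = (if \<epsilon> = \<delta> then 1 else - 1)"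
    using sgn by (simp only:)
  have aw: "angle_map \<epsilon> (oval \<delta> t) = angle_vec \<epsilon> w"
    by (simp only: oval_def angle_map_line w_def)
  show ?thesis
  proof (cases "\<epsilon> = \<delta>")
    case True
    then have "angle_vec \<epsilon> w = (w 1 + \<i> * w 2) / w 0" using sw by (intro angle_vec_pos) simp
    also have "\<dots> = exp (2 * of_real pi * \<i> * of_real t)" using cs by (simp add: w_def)
    finally show ?thesis using True aw by simp
  next
    case False
    then have "angle_vec \<epsilon> w = 1" using sw by (intro angle_vec_neg) simp
    then show ?thesis using False aw by simp
  qed
qed

text \<open>
  One oval is mapped to the unit circle, traversed once, and the other one to a point.
\<close>

lemma turning_oval:
  assumes "\<epsilon> \<in> {1, - 1}" "\<delta> \<in> {1, - 1}"
  shows "turning (angle_map \<epsilon>) (loop_simplex (oval \<delta>)) = (if \<epsilon> = \<delta> then 1 else 0)"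
proof (cases "\<epsilon> = \<delta>")
  case True
  have "angle_map \<epsilon> \<circ> oval \<delta> = circlepath 0 1"
    using angle_map_oval [OF assms] True by (simp add: circlepath o_def)
  then show ?thesis using True by (simp add: turning_loop winding_number_circlepath_centre)
next
  case False
  have "winding_number (angle_map \<epsilon> \<circ> oval \<delta>) 0 = 0"
    using angle_map_oval [OF assms] False by (intro winding_number_constI [of 1]) simp_all
  then show ?thesis using False by (simp add: turning_loop)
qed

definition oval_cycle :: "real \<Rightarrow> point chain" where
  "oval_cycle \<delta> = frag_of (loop_simplex (oval \<delta>))"

lemma boundary_oval_cycle: "chain_boundary 1 (oval_cycle \<delta>) = 0"
  unfolding oval_cycle_def by (rule chain_boundary_loop) (simp add: oval_def)

lemma oval_cycle_in_mod2_cycles: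
  assumes "\<delta> \<in> {1, - 1}"
  shows "oval_cycle \<delta> \<in> mod2_cycles 1 (real_locus 3 two_oval_curve)"
proof -
  have "\<delta>\<^sup>2 = 1" using assms by auto
  then have "singular_chain 1 (real_locus 3 two_oval_curve) (oval_cycle \<delta>)"
    unfolding oval_cycle_def singular_chain_of
    by (intro singular_simplex_loop continuous_oval)
  moreover have "chain_boundary 1 (oval_cycle \<delta>) = frag_cmul 2 0"
    by (simp only: boundary_oval_cycle frag_cmul_zero2)
  ultimately show ?thesis unfolding mod2_cycles_def using singular_chain_0 by blast
qed

lemma not_mod2_boundary_of_odd_turning:
  assumes "chain_boundary 1 c = 0" "\<epsilon> \<in> {1, - 1}" "frag_sum (turning (angle_map \<epsilon>)) c = 1"
  shows "c \<notin> mod2_boundaries 1 (real_locus 3 two_oval_curve)"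
proof
  assume "c \<in> mod2_boundaries 1 (real_locus 3 two_oval_curve)"
  moreover have "\<epsilon> \<noteq> 0" using assms(2) by auto
  ultimately obtain k where "frag_sum (turning (angle_map \<epsilon>)) c = 2 * of_int k"
    using turning_mod2_boundary [OF continuous_angle_map [OF \<open>\<epsilon> \<noteq> 0\<close>] assms(1)] by blast
  then have "complex_of_int 1 = of_int (2 * k)" using assms(3) by simp
  then have "1 = 2 * k" unfolding of_int_eq_iff .
  then show False by presburger
qed

text \<open>
  The differences of the cycles \<open>0\<close> and the two ovals each have an odd winding number for one of the
  two angle maps.
\<close>

lemma niveau_has_three_elements:
  "\<exists>A\<subseteq>niveau 1 1 3 two_oval_curve. card A = 3"
proof -
  let ?T = "real_locus 3 two_oval_curve"
  let ?c = "oval_cycle 1" and ?c' = "oval_cycle (- 1)"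
  have "zdim 3 two_oval_curve \<le> enat 1"
    using zdim_cofinite_curve_le [OF cofinite_two_oval_curve] by (simp add: one_enat_def)
  then obtain \<Phi> where \<Phi>: "\<And>c. c \<in> mod2_cycles 1 ?T \<Longrightarrow> \<Phi> c \<in> niveau 1 1 3 two_oval_curve"
    and inj: "\<And>c c'. \<lbrakk>c \<in> mod2_cycles 1 ?T; c' \<in> mod2_cycles 1 ?T; \<Phi> c = \<Phi> c'\<rbrakk>
      \<Longrightarrow> c - c' \<in> mod2_boundaries 1 ?T"
    using niveau_of_whole_variety [OF real_zclosed_curve, of 1 1] by blast
  have c: "?c \<in> mod2_cycles 1 ?T" "?c' \<in> mod2_cycles 1 ?T" "0 \<in> mod2_cycles 1 ?T"
    using oval_cycle_in_mod2_cycles by (simp_all, auto simp: mod2_cycles_def intro: exI [of _ 0])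
  have turn: "frag_sum (turning (angle_map \<epsilon>)) (oval_cycle \<delta>) = (if \<epsilon> = \<delta> then 1 else 0)"
    if "\<epsilon> \<in> {1, - 1}" "\<delta> \<in> {1, - 1}" for \<epsilon> \<delta>
    using turning_oval [OF that] by (simp add: oval_cycle_def)
  have "?c - 0 \<notin> mod2_boundaries 1 ?T"
    using turn by (intro not_mod2_boundary_of_odd_turning [of _ 1])
      (simp_all only: boundary_oval_cycle diff_zero, simp_all)
  moreover have "?c' - 0 \<notin> mod2_boundaries 1 ?T"
    using turn by (intro not_mod2_boundary_of_odd_turning [of _ "- 1"])
      (simp_all only: boundary_oval_cycle diff_zero, simp_all)
  moreover have "?c - ?c' \<notin> mod2_boundaries 1 ?T"
    using turn by (intro not_mod2_boundary_of_odd_turning [of _ 1])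
      (simp_all only: boundary_oval_cycle chain_boundary_diff frag_sum_diff diff_zero, simp_all)
  ultimately have "\<Phi> ?c \<noteq> \<Phi> 0" "\<Phi> ?c' \<noteq> \<Phi> 0" "\<Phi> ?c \<noteq> \<Phi> ?c'" using inj c by blast+
  then have "card {\<Phi> 0, \<Phi> ?c, \<Phi> ?c'} = 3" by auto
  moreover have "{\<Phi> 0, \<Phi> ?c, \<Phi> ?c'} \<subseteq> niveau 1 1 3 two_oval_curve" using \<Phi> c by simp
  ultimately show ?thesis by blast
qed

section \<open>The counterexample\<close>

theorem theorem1p2:
  "\<exists>(N::nat) (X::point set) (q::nat) (n::nat).
     smooth_projective_real_variety N X \<and> q \<le> n \<and>
     cyc q n N X ` RLH q n (proj_var N X) \<noteq> niveau (2 * n - q) n N X"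
proof -
  have "smooth_projective_real_variety 3 two_oval_curve"
    using real_zclosed_curve smooth_two_oval_curve
    by (simp add: smooth_projective_real_variety_def)
  moreover have "cyc 1 1 3 two_oval_curve ` RLH 1 1 (proj_var 3 two_oval_curve) \<noteq>
      niveau (2 * 1 - 1) 1 3 two_oval_curve" (is "?I \<noteq> _")
  proof
    assume eq: "?I = niveau (2 * 1 - 1) 1 3 two_oval_curve"
    have R: "finite (RLH 1 1 (proj_var 3 two_oval_curve))"
      "card (RLH 1 1 (proj_var 3 two_oval_curve)) \<le> 2"
      using RLH_diagonal_single [OF subvarieties_cofinite_curve [OF cofinite_two_oval_curve]
          conj_two_oval_curve] by blast+
    obtain A where A: "A \<subseteq> niveau 1 1 3 two_oval_curve" "card A = 3"
      using niveau_has_three_elements by blast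
    have "niveau 1 1 3 two_oval_curve = ?I" using eq by simp
    then have "card A \<le> card ?I"
      using A(1) card_mono [OF finite_imageI [OF R(1)]] by simp
    also have "\<dots> \<le> 2" using card_image_le [OF R(1)] R(2) by (rule order_trans)
    finally show False using A(2) by simp
  qed
  ultimately show ?thesis by blast
qed

end
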